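(* Let $\mathbf{S}=(S^x)_{x\in I}$ be a family of semimartingales such that the map $I\to\mathcal{S}(\mathbb{P})$, $x\mapsto S^x$, is continuous. Let $(\mathbf{H}^n)_{n\ge1}$ be a sequence of generalized integrands (with respect to $\mathbf{S}$) such that $(\mathbf{H}^n\cdot\mathbf{S})_{n\ge1}$ is a Cauchy sequence in $\mathcal{S}(\mathbb{P})$. Then there exists a generalized integrand $\mathbf{H}$ such that $\lim_{n\to\infty}\mathbf{H}^n\cdot\mathbf{S}=\mathbf{H}\cdot\mathbf{S}$ in $\mathcal{S}(\mathbb{P})$.
   Context: $(\Omega,\mathcal{F},(\mathcal{F}_t)_{0\le t\le T},\mathbb{P})$ is a filtered probability space satisfying the usual hypotheses, with finite horizon $T$. $\mathcal{S}(\mathbb{P})$ is the space of real-valued semimartingales on $[0,T]$ with the Emery (semimartingale) topology, for which it is a complete metric space. $I$ is a locally compact subset of $\mathbb{R}$. $E=\mathbb{R}^I$ carries the product topology; its dual $E'$ is the space of finite linear combinations of Dirac measures $\delta_x$, $x\in I$, where $\delta_x(f)=f(x)$. A simple integrand is a process $H_{\omega,t}=\sum_{i\le n}h^i_{\omega,t}\delta_{x_i}$ with $x_i\in I$ and $h^i$ bounded real predictable processes; its integral is $(H\cdot\mathbf{S})_t=\int_0^t\sum_{i\le n}h^i_s\,dS^{x_i}_s$. $\mathcal{U}$ is the set of not-necessarily-continuous functionals on $E$: linear functionals $k$ whose domain $\mathrm{Dom}(k)$ is a linear subspace of $E$. A sequence $(k^n)$ in $E'$ converges to $k\in\mathcal{U}$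 if $\lim_n k^n(f)=k(f)$ for all $f\in\mathrm{Dom}(k)$. For any sequence $(k^n)$ in $E'$ the limit functional $k=\lim_n k^n\in\mathcal{U}$ is defined with $\mathrm{Dom}(k)=\{f\in E:\lim_n k^n(f)\text{ exists}\}$ (possibly $\{0\}$). A predictable set $C\subset\Omega\times[0,T]$ is negligible with respect to $\mathbf{S}$ if, for a countable dense subset $\{x_n\}$ of $I$, $\int h\,dS^{x_n}=0$ for every $n$ and every bounded predictable $h$ vanishing on the complement of $C$ (this does not depend on the choice of the dense subset). A property holds a.s. if it holds on a subset of $\Omega\times[0,T]$ whose complement is negligible with respect to $\mathbf{S}$. A $\mathcal{U}$-valued process $\mathbf{H}$ is a generalized integrand (is integrable with respect to $\mathbf{S}$) if there is a sequence $(H^n)$ of simple integrands such that (i) $H^n$ converges to $\mathbf{H}$ a.s., and (ii) $(H^n\cdot\mathbf{S})$ converges to a semimartingale $Y$ in $\mathcal{S}(\mathbb{P})$. One then sets $\mathbf{H}\cdot\mathbf{S}=\int\mathbf{H}\,d\mathbf{S}=Y$. *)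

theory Defs
  imports "HOL-Probability.Probability"
begin

section \<open>Filtered probability spaces and processes\<close>

text \<open>
  A process is a function \<open>X t \<omega>\<close>; only its values for \<open>t \<in> {0..T}\<close> and \<open>\<omega> \<in> space M\<close> matter.
  The library's filtrations are indexed by the whole type, so \<open>F\<close> is indexed by all reals, but only
  the \<open>F t\<close> with \<open>t \<in> {0..T}\<close> are relevant: every filtration indexed by \<open>{0..T}\<close> extends to the reals
  as a constant on both sides.
\<close>

locale usual_filtered_space =
  prob_space M + complete_measure M + filtration "space M" F
  for M :: "'a measure" and F :: "real \<Rightarrow> 'a measure" +
  fixes T :: real
  assumes horizon_pos: "0 < T"
    and sets_F_subset: "\<And>t. t \<in> {0..T} \<Longrightarrow> sets (F t) \<subseteq> sets M"
    and null_sets_F: "null_sets M \<subseteq> sets (F 0)"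
    and F_right_continuous:
      "\<And>t. 0 \<le> t \<Longrightarrow> t < T \<Longrightarrow> sets (F t) = (\<Inter>s\<in>{t<..T}. sets (F s))"

definition cadlag_on :: "real \<Rightarrow> (real \<Rightarrow> real) \<Rightarrow> bool" where
  "cadlag_on T f \<longleftrightarrow>
     (\<forall>t. 0 \<le> t \<and> t < T \<longrightarrow> (f \<longlongrightarrow> f t) (at_right t)) \<and>
     (\<forall>t. 0 < t \<and> t \<le> T \<longrightarrow> (\<exists>l. (f \<longlongrightarrow> l) (at_left t)))"

definition adapted_cadlag ::
  "'a measure \<Rightarrow> (real \<Rightarrow> 'a measure) \<Rightarrow> real \<Rightarrow> (real \<Rightarrow> 'a \<Rightarrow> real) \<Rightarrow> bool" where
  "adapted_cadlag M F T X \<longleftrightarrow>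
     (\<forall>t\<in>{0..T}. X t \<in> borel_measurable (F t)) \<and> (AE \<omega> in M. cadlag_on T (\<lambda>t. X t \<omega>))"

definition predictable_sigma ::
  "'a measure \<Rightarrow> (real \<Rightarrow> 'a measure) \<Rightarrow> real \<Rightarrow> ('a \<times> real) measure" where
  "predictable_sigma M F T = sigma (space M \<times> {0..T})
     ({A \<times> {0} | A. A \<in> sets (F 0)} \<union>
      {A \<times> {s<..t} | A s t. 0 \<le> s \<and> s < t \<and> t \<le> T \<and> A \<in> sets (F s)})"

definition bounded_predictable ::
  "'a measure \<Rightarrow> (real \<Rightarrow> 'a measure) \<Rightarrow> real \<Rightarrow> (real \<Rightarrow> 'a \<Rightarrow> real) \<Rightarrow> bool" where
  "bounded_predictable M F T h \<longleftrightarrow>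
     (\<lambda>(\<omega>, t). h t \<omega>) \<in> borel_measurable (predictable_sigma M F T) \<and>
     (\<exists>C. \<forall>t\<in>{0..T}. \<forall>\<omega>\<in>space M. \<bar>h t \<omega>\<bar> \<le> C)"

text \<open>
  The metric \<open>E[1 \<and> sup\<^sub>t |X\<^sub>t - Y\<^sub>t|]\<close> of uniform convergence in probability; it vanishes iff
  \<open>X\<close> and \<open>Y\<close> are indistinguishable.
\<close>

definition ucp_dist ::
  "'a measure \<Rightarrow> real \<Rightarrow> (real \<Rightarrow> 'a \<Rightarrow> real) \<Rightarrow> (real \<Rightarrow> 'a \<Rightarrow> real) \<Rightarrow> ennreal" where
  "ucp_dist M T X Y = (\<integral>\<^sup>+\<omega>. min 1 (SUP t\<in>{0..T}. ennreal \<bar>X t \<omega> - Y t \<omega>\<bar>) \<partial>M)"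


section \<open>Simple predictable processes, semimartingales, the Emery topology\<close>

text \<open>
  The pair \<open>(h0, [(h\<^sub>1, \<sigma>\<^sub>1, \<tau>\<^sub>1), \<dots>])\<close> represents the simple predictable process
  \<open>h0 1\<^bsub>{0}\<^esub> + \<Sum>\<^sub>i h\<^sub>i 1\<^bsub>(\<sigma>\<^sub>i, \<tau>\<^sub>i]\<^esub>\<close> with stopping times \<open>\<sigma>\<^sub>i \<le> \<tau>\<^sub>i\<close> and bounded \<open>F\<^bsub>\<sigma>\<^sub>i\<^esub>\<close>-measurable \<open>h\<^sub>i\<close>.
  Overlapping intervals are allowed; this gives the same class of processes as increasing sequences
  of stopping times.
\<close>

type_synonym 'a simple_rep = "('a \<Rightarrow> real) \<times> (('a \<Rightarrow> real) \<times> ('a \<Rightarrow> real) \<times> ('a \<Rightarrow> real)) list"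

definition simple_predictable ::
  "'a measure \<Rightarrow> (real \<Rightarrow> 'a measure) \<Rightarrow> real \<Rightarrow> 'a simple_rep \<Rightarrow> bool" where
  "simple_predictable M F T R \<longleftrightarrow>
     fst R \<in> borel_measurable (F 0) \<and> (\<exists>C. \<forall>\<omega>\<in>space M. \<bar>fst R \<omega>\<bar> \<le> C) \<and>
     (\<forall>(h, \<sigma>, \<tau>)\<in>set (snd R).
        stopping_time F \<sigma> \<and> stopping_time F \<tau> \<and>
        (\<forall>\<omega>\<in>space M. 0 \<le> \<sigma> \<omega> \<and> \<sigma> \<omega> \<le> \<tau> \<omega> \<and> \<tau> \<omega> \<le> T) \<and>
        h \<in> borel_measurable (filtration.pre_sigma (space M) F \<sigma>) \<and>
        (\<exists>C. \<forall>\<omega>\<in>space M. \<bar>h \<omega>\<bar> \<le> C))"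

definition simple_process :: "'a simple_rep \<Rightarrow> real \<Rightarrow> 'a \<Rightarrow> real" where
  "simple_process R t \<omega> =
     (if t = 0 then fst R \<omega>
      else (\<Sum>(h, \<sigma>, \<tau>)\<leftarrow>snd R. if \<sigma> \<omega> < t \<and> t \<le> \<tau> \<omega> then h \<omega> else 0))"

text \<open>Integrals \<open>\<integral>\<^sub>0\<^sup>t\<close> are over \<open>(0, t]\<close>: they start at 0 and the value of the integrand at time 0 is
  irrelevant.\<close>

definition simple_integral ::
  "(real \<Rightarrow> 'a \<Rightarrow> real) \<Rightarrow> 'a simple_rep \<Rightarrow> real \<Rightarrow> 'a \<Rightarrow> real" where
  "simple_integral X R t \<omega> =
     (\<Sum>(h, \<sigma>, \<tau>)\<leftarrow>snd R. h \<omega> * (X (min (\<tau> \<omega>) t) \<omega> - X (min (\<sigma> \<omega>) t) \<omega>))"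

text \<open>
  Semimartingales as in Protter, \<^emph>\<open>Stochastic Integration and Differential Equations\<close>, Chapter II:
  adapted cadlag processes for which the elementary integral, from the simple predictable processes
  with uniform convergence to the random variables with convergence in probability, is continuous.
\<close>

definition semimartingale ::
  "'a measure \<Rightarrow> (real \<Rightarrow> 'a measure) \<Rightarrow> real \<Rightarrow> (real \<Rightarrow> 'a \<Rightarrow> real) \<Rightarrow> bool" where
  "semimartingale M F T X \<longleftrightarrow>
     adapted_cadlag M F T X \<and>
     (\<forall>Q R. (\<forall>n. simple_predictable M F T (Q n)) \<and> simple_predictable M F T R \<and>
        uniform_limit ({0..T} \<times> space M) (\<lambda>n (t, \<omega>). simple_process (Q n) t \<omega>)
          (\<lambda>(t, \<omega>). simple_process R t \<omega>) sequentially \<longrightarrow>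
        (\<forall>\<epsilon>>0. (\<lambda>n. measure M {\<omega>\<in>space M.
            \<epsilon> < \<bar>simple_integral X (Q n) T \<omega> - simple_integral X R T \<omega>\<bar>}) \<longlonglongrightarrow> 0))"

text \<open>
  The Emery metric \<open>E[1 \<and> |X\<^sub>0 - Y\<^sub>0|] + sup {E[1 \<and> sup\<^sub>t |(H \<cdot> (X - Y))\<^sub>t|] | |H| \<le> 1}\<close>, \<open>H\<close> ranging over
  the simple predictable processes. The first term is needed because integrals are over \<open>(0, t]\<close>.
\<close>

definition emery_dist ::
  "'a measure \<Rightarrow> (real \<Rightarrow> 'a measure) \<Rightarrow> real \<Rightarrow>
   (real \<Rightarrow> 'a \<Rightarrow> real) \<Rightarrow> (real \<Rightarrow> 'a \<Rightarrow> real) \<Rightarrow> ennreal" where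
  "emery_dist M F T X Y =
     (\<integral>\<^sup>+\<omega>. min 1 (ennreal \<bar>X 0 \<omega> - Y 0 \<omega>\<bar>) \<partial>M) +
     (SUP R\<in>{R. simple_predictable M F T R \<and>
                (\<forall>t\<in>{0..T}. \<forall>\<omega>\<in>space M. \<bar>simple_process R t \<omega>\<bar> \<le> 1)}.
        ucp_dist M T (simple_integral X R) (simple_integral Y R))"

definition emery_tendsto ::
  "'a measure \<Rightarrow> (real \<Rightarrow> 'a measure) \<Rightarrow> real \<Rightarrow>
   (nat \<Rightarrow> real \<Rightarrow> 'a \<Rightarrow> real) \<Rightarrow> (real \<Rightarrow> 'a \<Rightarrow> real) \<Rightarrow> bool" where
  "emery_tendsto M F T Z Y \<longleftrightarrow>
     (\<forall>n. semimartingale M F T (Z n)) \<and> semimartingale M F T Y \<and>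
     (\<lambda>n. emery_dist M F T (Z n) Y) \<longlonglongrightarrow> 0"

definition emery_Cauchy ::
  "'a measure \<Rightarrow> (real \<Rightarrow> 'a measure) \<Rightarrow> real \<Rightarrow> (nat \<Rightarrow> real \<Rightarrow> 'a \<Rightarrow> real) \<Rightarrow> bool" where
  "emery_Cauchy M F T Z \<longleftrightarrow>
     (\<forall>n. semimartingale M F T (Z n)) \<and>
     (\<forall>\<epsilon>>0. \<exists>N. \<forall>m\<ge>N. \<forall>n\<ge>N. emery_dist M F T (Z m) (Z n) < \<epsilon>)"

definition emery_continuous_family ::
  "'a measure \<Rightarrow> (real \<Rightarrow> 'a measure) \<Rightarrow> real \<Rightarrow> real set \<Rightarrow>
   (real \<Rightarrow> real \<Rightarrow> 'a \<Rightarrow> real) \<Rightarrow> bool" where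
  "emery_continuous_family M F T I S \<longleftrightarrow>
     (\<forall>x\<in>I. semimartingale M F T (S x)) \<and>
     (\<forall>x\<in>I. ((\<lambda>y. emery_dist M F T (S y) (S x)) \<longlongrightarrow> 0) (at x within I))"


section \<open>Stochastic integrals of bounded predictable processes\<close>

text \<open>
  \<open>has_stochastic_integral M F T X h Y\<close> means \<open>Y = \<integral> h dX\<close> up to indistinguishability. For a
  semimartingale \<open>X\<close> the integral on bounded predictable processes is the unique extension of the
  elementary integral satisfying the dominated convergence theorem, so its graph is the closure of
  the elementary integral under bounded pointwise limits of integrands. The integrands reached are
  exactly the bounded predictable ones, by the monotone class theorem.
\<close>

inductive has_stochastic_integral ::
  "'a measure \<Rightarrow> (real \<Rightarrow> 'a measure) \<Rightarrow> real \<Rightarrow> (real \<Rightarrow> 'a \<Rightarrow> real) \<Rightarrow>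
   (real \<Rightarrow> 'a \<Rightarrow> real) \<Rightarrow> (real \<Rightarrow> 'a \<Rightarrow> real) \<Rightarrow> bool"
  for M F T X where
  simple: "simple_predictable M F T R \<Longrightarrow>
     has_stochastic_integral M F T X (simple_process R) (simple_integral X R)"
| limit: "\<lbrakk>\<And>n. has_stochastic_integral M F T X (h n) (Z n);
     \<And>n t \<omega>. t \<in> {0..T} \<Longrightarrow> \<omega> \<in> space M \<Longrightarrow> \<bar>h n t \<omega>\<bar> \<le> C;
     \<And>t \<omega>. t \<in> {0..T} \<Longrightarrow> \<omega> \<in> space M \<Longrightarrow> (\<lambda>n. h n t \<omega>) \<longlonglongrightarrow> g t \<omega>;
     adapted_cadlag M F T Y;
     (\<lambda>n. ucp_dist M T (Z n) Y) \<longlonglongrightarrow> 0\<rbrakk> \<Longrightarrow>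
     has_stochastic_integral M F T X g Y"


section \<open>Generalized integrands\<close>

text \<open>
  \<open>\<real>\<^sup>I\<close> is represented by the functions vanishing off \<open>I\<close>, so that its vector operations are the
  pointwise ones.
\<close>

definition function_space :: "real set \<Rightarrow> (real \<Rightarrow> real) set" where
  "function_space I = {f. \<forall>x. x \<notin> I \<longrightarrow> f x = 0}"

text \<open>The set \<open>\<U>\<close>: the domain of a functional is the domain \<open>dom k\<close> of the partial function \<open>k\<close>.\<close>

definition partial_functionals :: "real set \<Rightarrow> ((real \<Rightarrow> real) \<rightharpoonup> real) set" where
  "partial_functionals I = {k.
     dom k \<subseteq> function_space I \<and> (\<lambda>x. 0) \<in> dom k \<and>
     (\<forall>f\<in>dom k. \<forall>g\<in>dom k. k (\<lambda>x. f x + g x) = Some (the (k f) + the (k g))) \<and>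
     (\<forall>c. \<forall>f\<in>dom k. k (\<lambda>x. c * f x) = Some (c * the (k f)))}"

definition functional_tendsto ::
  "(nat \<Rightarrow> (real \<Rightarrow> real) \<Rightarrow> real) \<Rightarrow> ((real \<Rightarrow> real) \<rightharpoonup> real) \<Rightarrow> bool" where
  "functional_tendsto \<kappa> k \<longleftrightarrow> (\<forall>f\<in>dom k. (\<lambda>n. \<kappa> n f) \<longlonglongrightarrow> the (k f))"

text \<open>
  \<open>K = \<Sum>\<^sub>i h\<^sub>i \<delta>\<^bsub>x\<^sub>i\<^esub>\<close> is a simple integrand, as a process with values in the dual of \<open>\<real>\<^sup>I\<close>, and
  \<open>Z = \<Sum>\<^sub>i \<integral> h\<^sub>i dS\<^bsup>x\<^sub>i\<^esup>\<close> is its integral; \<open>h i t \<omega> * f (x i)\<close> is \<open>h\<^sub>i \<delta>\<^bsub>x\<^sub>i\<^esub>\<close> evaluated at \<open>f\<close>.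
\<close>

definition has_simple_integrand_integral ::
  "'a measure \<Rightarrow> (real \<Rightarrow> 'a measure) \<Rightarrow> real \<Rightarrow> real set \<Rightarrow> (real \<Rightarrow> real \<Rightarrow> 'a \<Rightarrow> real) \<Rightarrow>
   (real \<Rightarrow> 'a \<Rightarrow> (real \<Rightarrow> real) \<Rightarrow> real) \<Rightarrow> (real \<Rightarrow> 'a \<Rightarrow> real) \<Rightarrow> bool" where
  "has_simple_integrand_integral M F T I S K Z \<longleftrightarrow>
     (\<exists>(m::nat) x h Y.
        (\<forall>i<m. x i \<in> I \<and> bounded_predictable M F T (h i) \<and>
               has_stochastic_integral M F T (S (x i)) (h i) (Y i)) \<and>
        (\<forall>t\<in>{0..T}. \<forall>\<omega>\<in>space M. \<forall>f\<in>function_space I. K t \<omega> f = (\<Sum>i<m. h i t \<omega> * f (x i))) \<and>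
        Z = (\<lambda>t \<omega>. \<Sum>i<m. Y i t \<omega>))"

definition negligible_wrt ::
  "'a measure \<Rightarrow> (real \<Rightarrow> 'a measure) \<Rightarrow> real \<Rightarrow> real set \<Rightarrow> (real \<Rightarrow> real \<Rightarrow> 'a \<Rightarrow> real) \<Rightarrow>
   ('a \<times> real) set \<Rightarrow> bool" where
  "negligible_wrt M F T I S C \<longleftrightarrow>
     C \<in> sets (predictable_sigma M F T) \<and>
     (\<exists>D. countable D \<and> D \<subseteq> I \<and> I \<subseteq> closure D \<and>
        (\<forall>x\<in>D. \<forall>h. bounded_predictable M F T h \<and>
            (\<forall>t\<in>{0..T}. \<forall>\<omega>\<in>space M. (\<omega>, t) \<notin> C \<longrightarrow> h t \<omega> = 0) \<longrightarrow>
            has_stochastic_integral M F T (S x) h (\<lambda>t \<omega>. 0)))"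

definition almost_surely_wrt ::
  "'a measure \<Rightarrow> (real \<Rightarrow> 'a measure) \<Rightarrow> real \<Rightarrow> real set \<Rightarrow> (real \<Rightarrow> real \<Rightarrow> 'a \<Rightarrow> real) \<Rightarrow>
   (real \<Rightarrow> 'a \<Rightarrow> bool) \<Rightarrow> bool" where
  "almost_surely_wrt M F T I S P \<longleftrightarrow>
     (\<exists>C. negligible_wrt M F T I S C \<and>
        (\<forall>t\<in>{0..T}. \<forall>\<omega>\<in>space M. (\<omega>, t) \<notin> C \<longrightarrow> P t \<omega>))"

text \<open>
  \<open>has_generalized_integral M F T I S H Y\<close> means that \<open>H\<close> is a generalized integrand with
  \<open>H \<cdot> S = Y\<close>. It is a relation, since nothing forces \<open>Y\<close> to be determined by \<open>H\<close> when the
  domains of the functionals \<open>H t \<omega>\<close> are small.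
\<close>

definition has_generalized_integral ::
  "'a measure \<Rightarrow> (real \<Rightarrow> 'a measure) \<Rightarrow> real \<Rightarrow> real set \<Rightarrow> (real \<Rightarrow> real \<Rightarrow> 'a \<Rightarrow> real) \<Rightarrow>
   (real \<Rightarrow> 'a \<Rightarrow> ((real \<Rightarrow> real) \<rightharpoonup> real)) \<Rightarrow> (real \<Rightarrow> 'a \<Rightarrow> real) \<Rightarrow> bool" where
  "has_generalized_integral M F T I S H Y \<longleftrightarrow>
     (\<forall>t\<in>{0..T}. \<forall>\<omega>\<in>space M. H t \<omega> \<in> partial_functionals I) \<and>
     (\<exists>K Z. (\<forall>n. has_simple_integrand_integral M F T I S (K n) (Z n)) \<and>
        almost_surely_wrt M F T I S (\<lambda>t \<omega>. functional_tendsto (\<lambda>n. K n t \<omega>) (H t \<omega>)) \<and>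
        emery_tendsto M F T Z Y)"

end

theory Submission
  imports Defs
begin

text \<open>
  The content is the completeness of the space of semimartingales. The Emery metric dominates the ucp
  metric, so a subsequence of \<open>Y\<close> converges almost surely, uniformly in time, to an adapted cadlag
  process \<open>Y'\<close>. Fatou's lemma, applied to every elementary integral, upgrades this to convergence in
  the Emery metric, and \<open>Y'\<close> is a semimartingale because the elementary integrals converge uniformly
  over the unit ball of simple predictable processes. Choosing for each \<open>n\<close> a simple integrand whose
  integral is \<open>1/(n+1)\<close>-close to \<open>Y n\<close> gives integrals converging to \<open>Y'\<close>; the integrand \<open>H'\<close> is
  the limit functional of these simple integrands, whose domain consists exactly of the functions at
  which they converge, so that no exceptional set is needed.
\<close>

section \<open>Limits of functions and functionals\<close>

text \<open>The preimages of a Borel set differ only inside a null set, which completeness makes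
  measurable. This serves for random times and suprema over an interval, which agree only almost
  everywhere with countable limits and suprema.\<close>

lemma (in complete_measure) borel_measurable_AE_cong:
  fixes f g :: "'a \<Rightarrow> 'b::topological_space"
  assumes f: "f \<in> borel_measurable M" and eq: "AE x in M. f x = g x"
  shows "g \<in> borel_measurable M"
proof (rule measurableI)
  fix B :: "'b set" assume B: "B \<in> sets borel"
  show "g -` B \<inter> space M \<in> sets M"
  proof (rule in_sets_AE)
    show "f -` B \<inter> space M \<in> sets M"
      using f B by (rule measurable_sets)
    show "AE x in M. x \<in> f -` B \<inter> space M \<longleftrightarrow> x \<in> g -` B \<inter> space M"
      using eq by eventually_elim auto
  qed simp
qed simp

text \<open>Reduction to a countable supremum, for the sake of measurability. By right continuity, a
  time whose value exceeds the right side is followed by a rational time with the same property.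
  This says nothing at \<open>b\<close>, so \<open>b\<close> joins the countable set.\<close>

lemma SUP_Icc_eq_SUP_Rats:
  fixes f :: "real \<Rightarrow> real"
  assumes rc: "\<And>t. a \<le> t \<Longrightarrow> t < b \<Longrightarrow> (f \<longlongrightarrow> f t) (at_right t)"
  shows "(SUP t\<in>{a..b}. ennreal \<bar>f t\<bar>) = (SUP t\<in>({a..b} \<inter> \<rat>) \<union> ({a..b} \<inter> {b}). ennreal \<bar>f t\<bar>)"
    (is "_ = ?R")
proof (rule antisym)
  show "(SUP t\<in>{a..b}. ennreal \<bar>f t\<bar>) \<le> ?R"
  proof (rule SUP_least)
    fix t assume t: "t \<in> {a..b}"
    show "ennreal \<bar>f t\<bar> \<le> ?R"
    proof (cases "t = b")
      case True
      then show ?thesis using t by (intro SUP_upper) auto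
    next
      case False
      with t have tb: "a \<le> t" "t < b" by auto
      show ?thesis
      proof (rule ccontr)
        assume "\<not> ?thesis"
        then have lt: "?R < ennreal \<bar>f t\<bar>" by simp
        have "((\<lambda>s. ennreal \<bar>f s\<bar>) \<longlongrightarrow> ennreal \<bar>f t\<bar>) (at_right t)"
          by (intro tendsto_ennrealI tendsto_rabs rc tb)
        then have "\<forall>\<^sub>F s in at_right t. ?R < ennreal \<bar>f s\<bar>"
          using lt by (rule order_tendstoD)
        moreover have "\<forall>\<^sub>F s in at_right t. s < b"
          using tb eventually_at_right_real by (force simp: eventually_at_right_field)
        ultimately have "\<forall>\<^sub>F s in at_right t. ?R < ennreal \<bar>f s\<bar> \<and> s < b"
          by (rule eventually_conj)
        then obtain c where c: "c > t" "\<And>s. t < s \<Longrightarrow> s < c \<Longrightarrow> ?R < ennreal \<bar>f s\<bar> \<and> s < b"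
          by (auto simp: eventually_at_right_field)
        obtain q where q: "q \<in> \<rat>" "t < q" "q < c"
          using Rats_dense_in_real[OF c(1)] by auto
        with c(2)[of q] tb have "ennreal \<bar>f q\<bar> \<le> ?R"
          by (intro SUP_upper) auto
        with c(2)[of q] q show False by auto
      qed
    qed
  qed
qed (auto intro!: SUP_subset_mono)

text \<open>Lower semicontinuity: a supremum above \<open>y\<close> is witnessed by some
  \<open>x\<close>, and \<open>f k x\<close> eventually exceeds \<open>y\<close> too. This is the
  pointwise half of the Fatou argument.\<close>

lemma min_SUP_le_liminf:
  fixes f :: "nat \<Rightarrow> 'b \<Rightarrow> ennreal"
  assumes lim: "\<And>x. x \<in> A \<Longrightarrow> (\<lambda>k. f k x) \<longlonglongrightarrow> g x"
  shows "min c (SUP x\<in>A. g x) \<le> liminf (\<lambda>k. min c (SUP x\<in>A. f k x))"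
  unfolding le_Liminf_iff
proof (intro allI impI)
  fix y assume y: "y < min c (SUP x\<in>A. g x)"
  then obtain x where x: "x \<in> A" "y < g x"
    by (auto simp: less_SUP_iff)
  from lim[OF x(1)] x(2) have "\<forall>\<^sub>F k in sequentially. y < f k x"
    by (rule order_tendstoD)
  then show "\<forall>\<^sub>F k in sequentially. y < min c (SUP x\<in>A. f k x)"
  proof eventually_elim
    case (elim k)
    then show ?case using y x(1) by (auto simp: less_SUP_iff)
  qed
qed

text \<open>Uniform convergence lets the limit in \<open>n\<close> be interchanged with one-sided
  limits in time. The candidate for the left limit of \<open>g\<close> comes from showing that the
  left limits of the \<open>f n\<close> are Cauchy.\<close>

lemma uniform_limit_cadlag_on:
  assumes cadlag: "\<And>n. cadlag_on T (f n)"
    and lim: "uniform_limit {0..T} f g sequentially"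
  shows "cadlag_on T g"
  unfolding cadlag_on_def
proof (intro conjI allI impI)
  fix t assume t: "0 \<le> t \<and> t < T"
  show "(g \<longlongrightarrow> g t) (at_right t)"
  proof (rule swap_uniform_limit'[OF _ _ lim])
    show "\<forall>\<^sub>F n in sequentially. (f n \<longlongrightarrow> f n t) (at_right t)"
      using cadlag t by (auto simp: cadlag_on_def)
    show "(\<lambda>n. f n t) \<longlonglongrightarrow> g t"
      using lim t by (intro tendsto_uniform_limitI) auto
    show "\<forall>\<^sub>F s in at_right t. s \<in> {0..T}"
      using t by (auto simp: eventually_at_right_field intro!: exI[of _ T])
  qed simp
next
  fix t assume t: "0 < t \<and> t \<le> T"
  have "\<exists>l. (f n \<longlongrightarrow> l) (at_left t)" for n
    using cadlag t by (auto simp: cadlag_on_def)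
  then obtain l where l: "\<And>n. (f n \<longlongrightarrow> l n) (at_left t)" by metis
  have ev: "\<forall>\<^sub>F s in at_left t. s \<in> {0..T}"
    using t by (auto simp: eventually_at_left_field intro!: exI[of _ 0])
  have "uniformly_Cauchy_on {0..T} f"
    using lim by (metis uniformly_convergent_on_def uniformly_convergent_Cauchy)
  have "Cauchy l"
  proof (rule metric_CauchyI)
    fix e :: real assume e: "0 < e"
    \<comment> \<open>The half leaves room for the strict inequality that is lost when
      \<open>s\<close> tends to \<open>t\<close>.\<close>
    obtain N where N: "\<And>s m n. s \<in> {0..T} \<Longrightarrow> m \<ge> N \<Longrightarrow> n \<ge> N \<Longrightarrow> dist (f m s) (f n s) < e / 2"
      using \<open>uniformly_Cauchy_on {0..T} f\<close> e unfolding uniformly_Cauchy_on_def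
      by (meson half_gt_zero)
    have "dist (l m) (l n) < e" if "m \<ge> N" "n \<ge> N" for m n
    proof -
      have "dist (l m) (l n) \<le> e / 2"
      proof (rule tendsto_upperbound)
        show "((\<lambda>s. dist (f m s) (f n s)) \<longlongrightarrow> dist (l m) (l n)) (at_left t)"
          by (intro tendsto_dist l)
        show "\<forall>\<^sub>F s in at_left t. dist (f m s) (f n s) \<le> e / 2"
          using ev by eventually_elim (use N that in \<open>auto intro: less_imp_le\<close>)
      qed simp
      then show ?thesis using e by simp
    qed
    then show "\<exists>N. \<forall>m\<ge>N. \<forall>n\<ge>N. dist (l m) (l n) < e" by blast
  qed
  then obtain l' where "l \<longlonglongrightarrow> l'"
    by (auto simp: Cauchy_convergent_iff convergent_def)
  then have "(g \<longlongrightarrow> l') (at_left t)"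
    by (intro swap_uniform_limit'[OF _ _ lim ev]) (auto simp: l)
  then show "\<exists>l. (g \<longlongrightarrow> l) (at_left t)" ..
qed

text \<open>If \<open>b\<close> or \<open>c\<close> reaches 1, the right side is already at least 1;
  otherwise nothing is truncated there. All triangle inequalities below rest on this.\<close>

lemma min_one_le_add:
  fixes a b c :: ennreal
  assumes "a \<le> b + c"
  shows "min 1 a \<le> min 1 b + min 1 c"
proof -
  consider "1 \<le> b" | "1 \<le> c" | "b \<le> 1" "c \<le> 1" by (meson linear)
  then show ?thesis
  proof cases
    case 3
    then show ?thesis using assms by (simp add: min.absorb2 min.coboundedI2)
  qed (simp_all add: min.absorb1 add_increasing add_increasing2 min.coboundedI1)
qed

section \<open>Limits of sequences in the dual as functionals with a domain\<close>

text \<open>The limit functional with its largest domain in the encoded product space, so that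
  convergence to it holds by construction.\<close>

definition limit_functional ::
  "real set \<Rightarrow> (nat \<Rightarrow> (real \<Rightarrow> real) \<Rightarrow> real) \<Rightarrow> (real \<Rightarrow> real) \<rightharpoonup> real" where
  "limit_functional I \<kappa> f =
     (if f \<in> function_space I \<and> convergent (\<lambda>n. \<kappa> n f) then Some (lim (\<lambda>n. \<kappa> n f)) else None)"

lemma functional_tendsto_limit_functional: "functional_tendsto \<kappa> (limit_functional I \<kappa>)"
  unfolding functional_tendsto_def
proof
  fix f assume "f \<in> dom (limit_functional I \<kappa>)"
  then have "convergent (\<lambda>n. \<kappa> n f)" "the (limit_functional I \<kappa> f) = lim (\<lambda>n. \<kappa> n f)"
    by (simp_all add: limit_functional_def dom_def split: if_splits)
  then show "(\<lambda>n. \<kappa> n f) \<longlonglongrightarrow> the (limit_functional I \<kappa> f)"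
    by (metis convergent_LIMSEQ_iff)
qed

lemma limit_functional_eq_SomeI:
  assumes "f \<in> function_space I" "(\<lambda>n. \<kappa> n f) \<longlonglongrightarrow> l"
  shows "limit_functional I \<kappa> f = Some l"
  using assms(1) convergentI[OF assms(2)] limI[OF assms(2)] by (simp add: limit_functional_def)

text \<open>Linearity of finite combinations of Dirac measures survives in the limit. Points and
  coefficients may change with \<open>n\<close>, and the formula is required only on
  \<open>function_space I\<close>, where simple integrands are prescribed.\<close>

lemma limit_functional_in_partial_functionals:
  assumes \<kappa>: "\<And>n. \<exists>(m::nat) x c. (\<forall>i<m. x i \<in> I) \<and>
      (\<forall>f\<in>function_space I. \<kappa> n f = (\<Sum>i<m. c i * f (x i)))"
  shows "limit_functional I \<kappa> \<in> partial_functionals I"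
proof -
  have add: "\<kappa> n (\<lambda>x. f x + g x) = \<kappa> n f + \<kappa> n g"
    if "f \<in> function_space I" "g \<in> function_space I" for n f g
  proof -
    obtain m :: nat and x c where "\<forall>f\<in>function_space I. \<kappa> n f = (\<Sum>i<m. c i * f (x i))"
      using \<kappa>[of n] by blast
    moreover have "(\<lambda>x. f x + g x) \<in> function_space I"
      using that by (simp add: function_space_def)
    ultimately show ?thesis
      using that by (simp add: distrib_left sum.distrib)
  qed
  have mult: "\<kappa> n (\<lambda>x. a * f x) = a * \<kappa> n f" if "f \<in> function_space I" for n f a
  proof -
    obtain m :: nat and x c where "\<forall>f\<in>function_space I. \<kappa> n f = (\<Sum>i<m. c i * f (x i))"
      using \<kappa>[of n] by blast
    moreover have "(\<lambda>x. a * f x) \<in> function_space I"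
      using that by (simp add: function_space_def)
    ultimately show ?thesis
      using that by (simp add: sum_distrib_left mult_ac)
  qed
  let ?k = "limit_functional I \<kappa>"
  have dom: "f \<in> function_space I" "(\<lambda>n. \<kappa> n f) \<longlonglongrightarrow> the (?k f)" if "f \<in> dom ?k" for f
    using that functional_tendsto_limit_functional[of \<kappa> I]
    by (auto simp: functional_tendsto_def limit_functional_def split: if_splits)
  have zero: "(\<lambda>x. 0) \<in> function_space I" by (simp add: function_space_def)
  show ?thesis
    unfolding partial_functionals_def
  proof (intro CollectI conjI ballI allI subsetI)
    show "f \<in> function_space I" if "f \<in> dom ?k" for f
      using dom(1)[OF that] .
    \<comment> \<open>Scaling by 0 gives \<open>\<kappa> n (\<lambda>x. 0) = 0\<close> for every
      \<open>n\<close>, a convergent sequence.\<close>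
    show "(\<lambda>x. 0) \<in> dom ?k"
      using limit_functional_eq_SomeI[OF zero, of \<kappa> 0] mult[OF zero, of _ 0] by auto
    show "?k (\<lambda>x. f x + g x) = Some (the (?k f) + the (?k g))" if "f \<in> dom ?k" "g \<in> dom ?k" for f g
    proof (rule limit_functional_eq_SomeI)
      show "(\<lambda>x. f x + g x) \<in> function_space I"
        using dom(1)[OF that(1)] dom(1)[OF that(2)] by (simp add: function_space_def)
      show "(\<lambda>n. \<kappa> n (\<lambda>x. f x + g x)) \<longlonglongrightarrow> the (?k f) + the (?k g)"
        using that by (simp add: add dom tendsto_add)
    qed
    show "?k (\<lambda>x. c * f x) = Some (c * the (?k f))" if "f \<in> dom ?k" for c f
    proof (rule limit_functional_eq_SomeI)
      show "(\<lambda>x. c * f x) \<in> function_space I"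
        using dom(1)[OF that] by (simp add: function_space_def)
      show "(\<lambda>n. \<kappa> n (\<lambda>x. c * f x)) \<longlonglongrightarrow> c * the (?k f)"
        using that by (simp add: mult dom tendsto_mult_left)
    qed
  qed
qed

section \<open>Simple predictable processes\<close>

text \<open>Since the intervals of a representation may overlap, concatenation with negated
  coefficients represents the difference without a common refinement of the stopping times.\<close>

definition simple_diff :: "'a simple_rep \<Rightarrow> 'a simple_rep \<Rightarrow> 'a simple_rep" where
  "simple_diff P Q = (\<lambda>\<omega>. fst P \<omega> - fst Q \<omega>,
     snd P @ map (\<lambda>(h, \<sigma>, \<tau>). (\<lambda>\<omega>. - h \<omega>, \<sigma>, \<tau>)) (snd Q))"

lemma simple_process_diff:
  fixes P Q :: "'a simple_rep"
  shows "simple_process (simple_diff P Q) t \<omega> = simple_process P t \<omega> - simple_process Q t \<omega>"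
proof -
  have "(\<Sum>(h, \<sigma>, \<tau>)\<leftarrow>map (\<lambda>(h, \<sigma>, \<tau>). (\<lambda>\<omega>. - h \<omega>, \<sigma>, \<tau>)) xs. if \<sigma> \<omega> < t \<and> t \<le> \<tau> \<omega> then h \<omega> else 0) =
      - (\<Sum>(h, \<sigma>, \<tau>)\<leftarrow>xs. if \<sigma> \<omega> < t \<and> t \<le> \<tau> \<omega> then h \<omega> else 0)"
    for xs :: "(('a \<Rightarrow> real) \<times> ('a \<Rightarrow> real) \<times> ('a \<Rightarrow> real)) list"
    by (induction xs) auto
  then show ?thesis by (simp add: simple_process_def simple_diff_def del: map_map)
qed

lemma simple_integral_diff:
  "simple_integral X (simple_diff P Q) t \<omega> = simple_integral X P t \<omega> - simple_integral X Q t \<omega>"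
proof -
  have "(\<Sum>(h, \<sigma>, \<tau>)\<leftarrow>map (\<lambda>(h, \<sigma>, \<tau>). (\<lambda>\<omega>. - h \<omega>, \<sigma>, \<tau>)) xs.
        h \<omega> * (X (min (\<tau> \<omega>) t) \<omega> - X (min (\<sigma> \<omega>) t) \<omega>)) =
      - (\<Sum>(h, \<sigma>, \<tau>)\<leftarrow>xs. h \<omega> * (X (min (\<tau> \<omega>) t) \<omega> - X (min (\<sigma> \<omega>) t) \<omega>))" for xs
    by (induction xs) (auto simp: algebra_simps)
  then show ?thesis by (simp add: simple_integral_def simple_diff_def del: map_map)
qed

lemma simple_predictable_diff:
  assumes P: "simple_predictable M F T P" and Q: "simple_predictable M F T Q"
  shows "simple_predictable M F T (simple_diff P Q)"
  unfolding simple_predictable_def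
proof (intro conjI)
  show "fst (simple_diff P Q) \<in> borel_measurable (F 0)"
    using P Q by (auto simp: simple_predictable_def simple_diff_def intro: borel_measurable_diff)
  obtain C C' where "\<forall>\<omega>\<in>space M. \<bar>fst P \<omega>\<bar> \<le> C" "\<forall>\<omega>\<in>space M. \<bar>fst Q \<omega>\<bar> \<le> C'"
    using P Q by (auto simp: simple_predictable_def)
  then have "\<forall>\<omega>\<in>space M. \<bar>fst P \<omega> - fst Q \<omega>\<bar> \<le> C + C'" by fastforce
  then show "\<exists>C. \<forall>\<omega>\<in>space M. \<bar>fst (simple_diff P Q) \<omega>\<bar> \<le> C"
    by (auto simp: simple_diff_def)
  show "\<forall>(h, \<sigma>, \<tau>)\<in>set (snd (simple_diff P Q)).
      stopping_time F \<sigma> \<and> stopping_time F \<tau> \<and>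
      (\<forall>\<omega>\<in>space M. 0 \<le> \<sigma> \<omega> \<and> \<sigma> \<omega> \<le> \<tau> \<omega> \<and> \<tau> \<omega> \<le> T) \<and>
      h \<in> borel_measurable (filtration.pre_sigma (space M) F \<sigma>) \<and>
      (\<exists>C. \<forall>\<omega>\<in>space M. \<bar>h \<omega>\<bar> \<le> C)"
  proof clarify
    fix h \<sigma> \<tau> assume "(h, \<sigma>, \<tau>) \<in> set (snd (simple_diff P Q))"
    then consider "(h, \<sigma>, \<tau>) \<in> set (snd P)"
      | h' where "(h', \<sigma>, \<tau>) \<in> set (snd Q)" "h = (\<lambda>\<omega>. - h' \<omega>)"
      by (auto simp: simple_diff_def)
    then show "stopping_time F \<sigma> \<and> stopping_time F \<tau> \<and>
      (\<forall>\<omega>\<in>space M. 0 \<le> \<sigma> \<omega> \<and> \<sigma> \<omega> \<le> \<tau> \<omega> \<and> \<tau> \<omega> \<le> T) \<and>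
      h \<in> borel_measurable (filtration.pre_sigma (space M) F \<sigma>) \<and>
      (\<exists>C. \<forall>\<omega>\<in>space M. \<bar>h \<omega>\<bar> \<le> C)"
    proof cases
      case 1
      then show ?thesis using P by (auto simp: simple_predictable_def)
    next
      case 2
      then show ?thesis using Q by (fastforce simp: simple_predictable_def)
    qed
  qed
qed

section \<open>Completeness of the Emery metric\<close>

context usual_filtered_space
begin

section \<open>Right-continuous processes and measurability of elementary integrals\<close>

text \<open>What measurability of the ucp integrand calls for. The class is stable under sums,
  products with random variables and stopping, hence under elementary integration.\<close>

definition right_continuous_process :: "(real \<Rightarrow> 'a \<Rightarrow> real) \<Rightarrow> bool" where
  "right_continuous_process X \<longleftrightarrow>
     (\<forall>t\<in>{0..T}. X t \<in> borel_measurable M) \<and>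
     (AE \<omega> in M. \<forall>t. 0 \<le> t \<and> t < T \<longrightarrow> ((\<lambda>s. X s \<omega>) \<longlongrightarrow> X t \<omega>) (at_right t))"

lemma measurable_F_imp_measurable:
  assumes "t \<in> {0..T}" "f \<in> borel_measurable (F t)"
  shows "f \<in> borel_measurable M"
  using measurable_mono[of borel borel "F t" M] sets_F_subset[OF assms(1)] assms(2) space_F
  by auto

lemma adapted_cadlag_right_continuous_process:
  assumes "adapted_cadlag M F T X"
  shows "right_continuous_process X"
  using assms measurable_F_imp_measurable
  unfolding adapted_cadlag_def right_continuous_process_def cadlag_on_def
  by (blast intro: eventually_mono)

lemma right_continuous_process_diff:
  assumes "right_continuous_process X" "right_continuous_process Y"
  shows "right_continuous_process (\<lambda>t \<omega>. X t \<omega> - Y t \<omega>)"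
  unfolding right_continuous_process_def
proof
  show "\<forall>t\<in>{0..T}. (\<lambda>\<omega>. X t \<omega> - Y t \<omega>) \<in> borel_measurable M"
    using assms by (auto simp: right_continuous_process_def intro: borel_measurable_diff)
  have "AE \<omega> in M. \<forall>t. 0 \<le> t \<and> t < T \<longrightarrow> ((\<lambda>s. X s \<omega>) \<longlongrightarrow> X t \<omega>) (at_right t)"
    "AE \<omega> in M. \<forall>t. 0 \<le> t \<and> t < T \<longrightarrow> ((\<lambda>s. Y s \<omega>) \<longlongrightarrow> Y t \<omega>) (at_right t)"
    using assms by (auto simp: right_continuous_process_def)
  then show "AE \<omega> in M. \<forall>t. 0 \<le> t \<and> t < T \<longrightarrow>
      ((\<lambda>s. X s \<omega> - Y s \<omega>) \<longlongrightarrow> X t \<omega> - Y t \<omega>) (at_right t)"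
    by eventually_elim (auto intro: tendsto_diff)
qed

lemma right_continuous_process_add:
  assumes "right_continuous_process X" "right_continuous_process Y"
  shows "right_continuous_process (\<lambda>t \<omega>. X t \<omega> + Y t \<omega>)"
  unfolding right_continuous_process_def
proof
  show "\<forall>t\<in>{0..T}. (\<lambda>\<omega>. X t \<omega> + Y t \<omega>) \<in> borel_measurable M"
    using assms by (auto simp: right_continuous_process_def intro: borel_measurable_add)
  have "AE \<omega> in M. \<forall>t. 0 \<le> t \<and> t < T \<longrightarrow> ((\<lambda>s. X s \<omega>) \<longlongrightarrow> X t \<omega>) (at_right t)"
    "AE \<omega> in M. \<forall>t. 0 \<le> t \<and> t < T \<longrightarrow> ((\<lambda>s. Y s \<omega>) \<longlongrightarrow> Y t \<omega>) (at_right t)"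
    using assms by (auto simp: right_continuous_process_def)
  then show "AE \<omega> in M. \<forall>t. 0 \<le> t \<and> t < T \<longrightarrow>
      ((\<lambda>s. X s \<omega> + Y s \<omega>) \<longlongrightarrow> X t \<omega> + Y t \<omega>) (at_right t)"
    by eventually_elim (auto intro: tendsto_add)
qed

lemma right_continuous_process_mult:
  assumes "right_continuous_process X" "h \<in> borel_measurable M"
  shows "right_continuous_process (\<lambda>t \<omega>. h \<omega> * X t \<omega>)"
  unfolding right_continuous_process_def
proof
  show "\<forall>t\<in>{0..T}. (\<lambda>\<omega>. h \<omega> * X t \<omega>) \<in> borel_measurable M"
    using assms by (auto simp: right_continuous_process_def intro: borel_measurable_times)
  have "AE \<omega> in M. \<forall>t. 0 \<le> t \<and> t < T \<longrightarrow> ((\<lambda>s. X s \<omega>) \<longlongrightarrow> X t \<omega>) (at_right t)"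
    using assms by (auto simp: right_continuous_process_def)
  then show "AE \<omega> in M. \<forall>t. 0 \<le> t \<and> t < T \<longrightarrow>
      ((\<lambda>s. h \<omega> * X s \<omega>) \<longlongrightarrow> h \<omega> * X t \<omega>) (at_right t)"
    by eventually_elim (auto intro: tendsto_mult_left)
qed

lemma right_continuous_process_const:
  "h \<in> borel_measurable M \<Longrightarrow> right_continuous_process (\<lambda>t. h)"
  by (auto simp: right_continuous_process_def)

text \<open>The value at a random time is the limit of the values at its discretizations from above,
  which take countably many values.\<close>

lemma right_continuous_process_measurable_at:
  assumes X: "right_continuous_process X"
    and \<tau>: "\<tau> \<in> borel_measurable M" "\<And>\<omega>. \<omega> \<in> space M \<Longrightarrow> \<tau> \<omega> \<in> {0..T}"
  shows "(\<lambda>\<omega>. X (\<tau> \<omega>) \<omega>) \<in> borel_measurable M"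
proof -
  \<comment> \<open>The \<open>+ 1\<close> places the discretization strictly after
    \<open>\<tau> \<omega>\<close>, as a right limit demands. The cap keeps it in the time interval,
    at the price of a separate case \<open>\<tau> \<omega> = T\<close>.\<close>
  define q where "q k \<omega> = min T ((real (nat \<lfloor>\<tau> \<omega> * Suc k\<rfloor>) + 1) / Suc k)" for k \<omega>
  have meas: "(\<lambda>\<omega>. X (q k \<omega>) \<omega>) \<in> borel_measurable M" for k
    unfolding q_def
  proof (rule measurable_compose_countable[where f = "\<lambda>i \<omega>. X (min T ((real i + 1) / Suc k)) \<omega>"])
    fix i
    have "min T ((real i + 1) / Suc k) \<in> {0..T}" using horizon_pos by auto
    then show "X (min T ((real i + 1) / Suc k)) \<in> borel_measurable M"
      using X by (auto simp: right_continuous_process_def simp del: of_nat_Suc)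
  qed (use \<tau>(1) in measurable)
  have lim: "(\<lambda>k. X (q k \<omega>) \<omega>) \<longlonglongrightarrow> X (\<tau> \<omega>) \<omega>"
    if \<omega>: "\<omega> \<in> space M" and
      rc: "\<forall>t. 0 \<le> t \<and> t < T \<longrightarrow> ((\<lambda>s. X s \<omega>) \<longlongrightarrow> X t \<omega>) (at_right t)" for \<omega>
  proof -
    note b = \<tau>(2)[OF \<omega>]
    have up: "\<tau> \<omega> < (real (nat \<lfloor>\<tau> \<omega> * Suc k\<rfloor>) + 1) / Suc k"
      and lo: "(real (nat \<lfloor>\<tau> \<omega> * Suc k\<rfloor>) + 1) / Suc k \<le> \<tau> \<omega> + 1 / Suc k" for k
    proof -
      have "real (nat \<lfloor>\<tau> \<omega> * Suc k\<rfloor>) = of_int \<lfloor>\<tau> \<omega> * Suc k\<rfloor>"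
        using b by simp
      moreover have "of_int \<lfloor>\<tau> \<omega> * Suc k\<rfloor> \<le> \<tau> \<omega> * Suc k" "\<tau> \<omega> * Suc k < of_int \<lfloor>\<tau> \<omega> * Suc k\<rfloor> + 1"
        by linarith+
      ultimately show "\<tau> \<omega> < (real (nat \<lfloor>\<tau> \<omega> * Suc k\<rfloor>) + 1) / Suc k"
        "(real (nat \<lfloor>\<tau> \<omega> * Suc k\<rfloor>) + 1) / Suc k \<le> \<tau> \<omega> + 1 / Suc k"
        by (simp_all only: pos_less_divide_eq pos_divide_le_eq of_nat_0_less_iff zero_less_Suc
            distrib_right) (simp_all del: of_nat_Suc)
    qed
    show ?thesis
    proof (cases "\<tau> \<omega> = T")
      case True
      then have "q k \<omega> = T" for k using up[of k] by (simp add: q_def del: of_nat_Suc)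
      then show ?thesis using True by simp
    next
      case False
      then have T: "0 \<le> \<tau> \<omega>" "\<tau> \<omega> < T" using b by auto
      have q_gt: "q k \<omega> > \<tau> \<omega>" and q_le: "q k \<omega> \<le> \<tau> \<omega> + 1 / Suc k" for k
        using up[of k] lo[of k] T by (auto simp: q_def simp del: of_nat_Suc)
      have "(\<lambda>k. q k \<omega>) \<longlonglongrightarrow> \<tau> \<omega>"
      proof (rule real_tendsto_sandwich)
        show "\<forall>\<^sub>F k in sequentially. \<tau> \<omega> \<le> q k \<omega>"
          using q_gt by (simp add: less_imp_le)
        show "\<forall>\<^sub>F k in sequentially. q k \<omega> \<le> \<tau> \<omega> + 1 / Suc k"
          using q_le by (simp del: of_nat_Suc)
        show "(\<lambda>k. \<tau> \<omega> + 1 / Suc k) \<longlonglongrightarrow> \<tau> \<omega>"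
          using tendsto_add[OF tendsto_const LIMSEQ_Suc[OF lim_1_over_n], of "\<tau> \<omega>"] by (simp del: of_nat_Suc)
      qed (rule tendsto_const)
      then have "filterlim (\<lambda>k. q k \<omega>) (at_right (\<tau> \<omega>)) sequentially"
        using q_gt by (simp add: filterlim_at less_imp_neq[symmetric])
      with rc[rule_format, OF conjI[OF T]] show ?thesis
        by (rule filterlim_compose)
    qed
  qed
  have "(\<lambda>\<omega>. lim (\<lambda>k. X (q k \<omega>) \<omega>)) \<in> borel_measurable M"
    using meas by measurable
  moreover have "AE \<omega> in M. \<forall>t. 0 \<le> t \<and> t < T \<longrightarrow> ((\<lambda>s. X s \<omega>) \<longlongrightarrow> X t \<omega>) (at_right t)"
    using X by (auto simp: right_continuous_process_def)
  then have "AE \<omega> in M. lim (\<lambda>k. X (q k \<omega>) \<omega>) = X (\<tau> \<omega>) \<omega>"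
    using AE_space by eventually_elim (intro limI lim)
  ultimately show ?thesis by (rule borel_measurable_AE_cong)
qed

text \<open>Just after \<open>t\<close>, the stopped path is constant if
  \<open>\<tau> \<omega> \<le> t\<close> and follows the path of \<open>X\<close> otherwise.\<close>

lemma right_continuous_process_stopped:
  assumes X: "right_continuous_process X"
    and \<tau>: "\<tau> \<in> borel_measurable M" "\<And>\<omega>. \<omega> \<in> space M \<Longrightarrow> \<tau> \<omega> \<in> {0..T}"
  shows "right_continuous_process (\<lambda>t \<omega>. X (min (\<tau> \<omega>) t) \<omega>)"
  unfolding right_continuous_process_def
proof
  show "\<forall>t\<in>{0..T}. (\<lambda>\<omega>. X (min (\<tau> \<omega>) t) \<omega>) \<in> borel_measurable M"
  proof
    fix t assume t: "t \<in> {0..T}"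
    show "(\<lambda>\<omega>. X (min (\<tau> \<omega>) t) \<omega>) \<in> borel_measurable M"
    proof (rule right_continuous_process_measurable_at[OF X, of "\<lambda>\<omega>. min (\<tau> \<omega>) t"])
      show "(\<lambda>\<omega>. min (\<tau> \<omega>) t) \<in> borel_measurable M"
        using \<tau>(1) by measurable
      show "min (\<tau> \<omega>) t \<in> {0..T}" if "\<omega> \<in> space M" for \<omega>
        using \<tau>(2)[OF that] t by auto
    qed
  qed
  have "AE \<omega> in M. \<forall>t. 0 \<le> t \<and> t < T \<longrightarrow> ((\<lambda>s. X s \<omega>) \<longlongrightarrow> X t \<omega>) (at_right t)"
    using X by (auto simp: right_continuous_process_def)
  then show "AE \<omega> in M. \<forall>t. 0 \<le> t \<and> t < T \<longrightarrow>
      ((\<lambda>s. X (min (\<tau> \<omega>) s) \<omega>) \<longlongrightarrow> X (min (\<tau> \<omega>) t) \<omega>) (at_right t)"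
  proof eventually_elim
    case (elim \<omega>)
    show ?case
    proof (intro allI impI)
      fix t assume t: "0 \<le> t \<and> t < T"
      show "((\<lambda>s. X (min (\<tau> \<omega>) s) \<omega>) \<longlongrightarrow> X (min (\<tau> \<omega>) t) \<omega>) (at_right t)"
      proof (cases "\<tau> \<omega> \<le> t")
        case True
        then have "\<forall>\<^sub>F s in at_right t. X (min (\<tau> \<omega>) s) \<omega> = X (min (\<tau> \<omega>) t) \<omega>"
          by (auto simp: eventually_at_right_field intro!: exI[of _ "t + 1"])
        then show ?thesis by (rule tendsto_eventually)
      next
        case False
        then have "\<forall>\<^sub>F s in at_right t. X s \<omega> = X (min (\<tau> \<omega>) s) \<omega>"
          by (auto simp: eventually_at_right_field min_def intro!: exI[of _ "\<tau> \<omega>"])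
        moreover have "((\<lambda>s. X s \<omega>) \<longlongrightarrow> X (min (\<tau> \<omega>) t) \<omega>) (at_right t)"
          using elim t False by (simp add: min_def)
        ultimately show ?thesis by (rule Lim_transform_eventually[rotated])
      qed
    qed
  qed
qed

text \<open>Sets of \<open>F t\<close> are known to lie in \<open>M\<close> only for
  \<open>t \<in> {0..T}\<close>; at other levels the range of a stopping time makes its sublevel set
  empty or the whole space. For \<open>h\<close>, the sigma-algebra at \<open>\<sigma>\<close> is
  tested at time \<open>T\<close>, where \<open>\<sigma> \<omega> \<le> T\<close> always
  holds.\<close>

lemma simple_predictable_measurable:
  assumes "simple_predictable M F T R" "(h, \<sigma>, \<tau>) \<in> set (snd R)"
  shows "h \<in> borel_measurable M" "\<sigma> \<in> borel_measurable M" "\<tau> \<in> borel_measurable M"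
    "\<And>\<omega>. \<omega> \<in> space M \<Longrightarrow> \<sigma> \<omega> \<in> {0..T}" "\<And>\<omega>. \<omega> \<in> space M \<Longrightarrow> \<tau> \<omega> \<in> {0..T}"
proof -
  have st: "stopping_time F \<sigma>" "stopping_time F \<tau>"
    and bd: "\<And>\<omega>. \<omega> \<in> space M \<Longrightarrow> 0 \<le> \<sigma> \<omega> \<and> \<sigma> \<omega> \<le> \<tau> \<omega> \<and> \<tau> \<omega> \<le> T"
    and h: "h \<in> borel_measurable (pre_sigma \<sigma>)"
    using assms unfolding simple_predictable_def by auto
  show range: "\<And>\<omega>. \<omega> \<in> space M \<Longrightarrow> \<sigma> \<omega> \<in> {0..T}" "\<And>\<omega>. \<omega> \<in> space M \<Longrightarrow> \<tau> \<omega> \<in> {0..T}"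
    using bd by fastforce+
  have meas: "\<rho> \<in> borel_measurable M"
    if \<rho>: "stopping_time F \<rho>" "\<And>\<omega>. \<omega> \<in> space M \<Longrightarrow> \<rho> \<omega> \<in> {0..T}" for \<rho>
  proof (rule borel_measurableI_le)
    fix t
    consider "t < 0" | "t \<in> {0..T}" | "t > T" by force
    then show "{\<omega> \<in> space M. \<rho> \<omega> \<le> t} \<in> sets M"
    proof cases
      case 1
      then have "{\<omega> \<in> space M. \<rho> \<omega> \<le> t} = {}" using \<rho>(2) by force
      then show ?thesis by (simp only: sets.empty_sets)
    next
      case 2
      then show ?thesis
        using stopping_timeD[OF \<rho>(1), of t] sets_F_subset[OF 2] by (auto simp: pred_def space_F)
    next
      case 3
      then have "{\<omega> \<in> space M. \<rho> \<omega> \<le> t} = space M" using \<rho>(2) by force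
      then show ?thesis by simp
    qed
  qed
  show "\<sigma> \<in> borel_measurable M" "\<tau> \<in> borel_measurable M"
    using meas st range by blast+
  show "h \<in> borel_measurable M"
  proof (rule measurableI)
    fix B :: "real set" assume "B \<in> sets borel"
    then have "h -` B \<inter> space M \<in> sets (pre_sigma \<sigma>)"
      using measurable_sets[OF h] by (simp add: space_pre_sigma)
    then have "{\<omega> \<in> h -` B \<inter> space M. \<sigma> \<omega> \<le> T} \<in> sets (F T)"
      by (rule sets_pre_sigmaD[OF st(1)])
    moreover have "{\<omega> \<in> h -` B \<inter> space M. \<sigma> \<omega> \<le> T} = h -` B \<inter> space M"
      using range(1) by auto
    ultimately show "h -` B \<inter> space M \<in> sets M"
      using sets_F_subset[of T] horizon_pos by auto
  qed simp
qed

lemma simple_integral_right_continuous_process: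
  assumes X: "right_continuous_process X" and R: "simple_predictable M F T R"
  shows "right_continuous_process (simple_integral X R)"
proof -
  \<comment> \<open>Sublists of the representation are considered so that each entry met in the
    induction still satisfies the conditions on \<open>R\<close>.\<close>
  have "right_continuous_process (\<lambda>t \<omega>. \<Sum>(h, \<sigma>, \<tau>)\<leftarrow>xs. h \<omega> * (X (min (\<tau> \<omega>) t) \<omega> - X (min (\<sigma> \<omega>) t) \<omega>))"
    if "set xs \<subseteq> set (snd R)" for xs
    using that
  proof (induction xs)
    case Nil
    then show ?case using right_continuous_process_const[of "\<lambda>_. 0"] by simp
  next
    case (Cons x xs)
    obtain h \<sigma> \<tau> where x: "x = (h, \<sigma>, \<tau>)" by (cases x)
    with Cons.prems have "(h, \<sigma>, \<tau>) \<in> set (snd R)" by auto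
    note m = simple_predictable_measurable[OF R this]
    show ?case
      unfolding x list.map prod.case sum_list.Cons
      using Cons m
      by (intro right_continuous_process_add right_continuous_process_mult
          right_continuous_process_diff right_continuous_process_stopped X) auto
  qed
  then show ?thesis unfolding simple_integral_def by blast
qed

section \<open>The metric of uniform convergence in probability\<close>

lemma ucp_integrand_measurable:
  assumes "right_continuous_process X" "right_continuous_process Y"
  shows "(\<lambda>\<omega>. min 1 (SUP t\<in>{0..T}. ennreal \<bar>X t \<omega> - Y t \<omega>\<bar>)) \<in> borel_measurable M"
proof -
  let ?D = "\<lambda>t \<omega>. X t \<omega> - Y t \<omega>" and ?C = "({0..T} \<inter> \<rat>) \<union> ({0..T} \<inter> {T})"
  note D = right_continuous_process_diff[OF assms]
  have "(\<lambda>\<omega>. SUP t\<in>?C. ennreal \<bar>?D t \<omega>\<bar>) \<in> borel_measurable M"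
    using D countable_rat by (intro borel_measurable_SUP measurable_compose[OF _ measurable_ennreal] borel_measurable_abs)
      (auto simp: right_continuous_process_def)
  moreover have "AE \<omega> in M. (SUP t\<in>?C. ennreal \<bar>?D t \<omega>\<bar>) = (SUP t\<in>{0..T}. ennreal \<bar>?D t \<omega>\<bar>)"
    using conjunct2[OF D[unfolded right_continuous_process_def]]
    by eventually_elim (rule SUP_Icc_eq_SUP_Rats[symmetric], blast)
  ultimately have "(\<lambda>\<omega>. SUP t\<in>{0..T}. ennreal \<bar>?D t \<omega>\<bar>) \<in> borel_measurable M"
    by (rule borel_measurable_AE_cong)
  then show ?thesis by measurable
qed

text \<open>One statement covers both the triangle inequality and the comparison with the Emery
  distance, where the two differences on the right come from different pairs of processes. Right
  continuity makes the integrands measurable, so that the integral of the sum splits.\<close>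

lemma ucp_dist_le_add:
  assumes le: "\<And>t \<omega>. t \<in> {0..T} \<Longrightarrow>
      \<bar>X t \<omega> - X' t \<omega>\<bar> \<le> \<bar>Y t \<omega> - Y' t \<omega>\<bar> + \<bar>Z t \<omega> - Z' t \<omega>\<bar>"
    and rc: "right_continuous_process Y" "right_continuous_process Y'"
      "right_continuous_process Z" "right_continuous_process Z'"
  shows "ucp_dist M T X X' \<le> ucp_dist M T Y Y' + ucp_dist M T Z Z'"
proof -
  let ?s = "\<lambda>X Y \<omega>. SUP t\<in>{0..T}. ennreal \<bar>X t \<omega> - Y t \<omega>\<bar>"
  have "?s X X' \<omega> \<le> ?s Y Y' \<omega> + ?s Z Z' \<omega>" for \<omega>
  proof (rule SUP_least)
    fix t assume t: "t \<in> {0..T}"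
    have "ennreal \<bar>X t \<omega> - X' t \<omega>\<bar> \<le> ennreal \<bar>Y t \<omega> - Y' t \<omega>\<bar> + ennreal \<bar>Z t \<omega> - Z' t \<omega>\<bar>"
      using le[OF t] by (simp flip: ennreal_plus)
    also have "\<dots> \<le> ?s Y Y' \<omega> + ?s Z Z' \<omega>"
      using t by (intro add_mono SUP_upper)
    finally show "ennreal \<bar>X t \<omega> - X' t \<omega>\<bar> \<le> ?s Y Y' \<omega> + ?s Z Z' \<omega>" .
  qed
  then have "ucp_dist M T X X' \<le> (\<integral>\<^sup>+\<omega>. min 1 (?s Y Y' \<omega>) + min 1 (?s Z Z' \<omega>) \<partial>M)"
    unfolding ucp_dist_def by (intro nn_integral_mono min_one_le_add)
  also have "\<dots> = ucp_dist M T Y Y' + ucp_dist M T Z Z'"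
    unfolding ucp_dist_def using rc by (intro nn_integral_add ucp_integrand_measurable)
  finally show ?thesis .
qed

lemma ucp_dist_triangle:
  assumes "right_continuous_process X" "right_continuous_process Y" "right_continuous_process Z"
  shows "ucp_dist M T X Z \<le> ucp_dist M T X Y + ucp_dist M T Y Z"
  using assms by (intro ucp_dist_le_add) auto

text \<open>Fatou's lemma combined with lower semicontinuity of the truncated supremum; pointwise
  convergence in time is enough.\<close>

lemma ucp_dist_fatou:
  assumes X: "right_continuous_process X" and Z: "\<And>k. right_continuous_process (Z k)"
    and lim: "AE \<omega> in M. \<forall>t\<in>{0..T}. (\<lambda>k. Z k t \<omega>) \<longlonglongrightarrow> Y t \<omega>"
    and le: "\<forall>\<^sub>F k in sequentially. ucp_dist M T X (Z k) \<le> e"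
  shows "ucp_dist M T X Y \<le> e"
proof -
  let ?s = "\<lambda>Y \<omega>. min 1 (SUP t\<in>{0..T}. ennreal \<bar>X t \<omega> - Y t \<omega>\<bar>)"
  have "ucp_dist M T X Y \<le> (\<integral>\<^sup>+\<omega>. liminf (\<lambda>k. ?s (Z k) \<omega>) \<partial>M)"
    unfolding ucp_dist_def
  proof (rule nn_integral_mono_AE)
    show "AE \<omega> in M. ?s Y \<omega> \<le> liminf (\<lambda>k. ?s (Z k) \<omega>)"
      using lim
    proof eventually_elim
      case (elim \<omega>)
      then show ?case
        by (intro min_SUP_le_liminf tendsto_ennrealI tendsto_rabs tendsto_diff tendsto_const) blast
    qed
  qed
  also have "\<dots> \<le> liminf (\<lambda>k. ucp_dist M T X (Z k))"
    unfolding ucp_dist_def by (intro nn_integral_liminf ucp_integrand_measurable X Z)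
  also have "\<dots> \<le> e"
    using le by (intro Liminf_le) auto
  finally show ?thesis .
qed

section \<open>The Emery distance: triangle inequality, Fatou property, comparison with ucp\<close>

definition unit_simple :: "'a simple_rep set" where
  "unit_simple = {R. simple_predictable M F T R \<and>
     (\<forall>t\<in>{0..T}. \<forall>\<omega>\<in>space M. \<bar>simple_process R t \<omega>\<bar> \<le> 1)}"

text \<open>The initial term becomes a ucp distance between processes constant in time, so that the
  ucp estimates apply to both terms.\<close>

lemma emery_dist_alt:
  "emery_dist M F T X Y = ucp_dist M T (\<lambda>t. X 0) (\<lambda>t. Y 0) +
     (SUP R\<in>unit_simple. ucp_dist M T (simple_integral X R) (simple_integral Y R))"
  using horizon_pos unfolding emery_dist_def unit_simple_def ucp_dist_def by simp

lemma emery_dist_ge_initial: "ucp_dist M T (\<lambda>t. X 0) (\<lambda>t. Y 0) \<le> emery_dist M F T X Y"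
  unfolding emery_dist_alt by simp

lemma emery_dist_ge_simple:
  "R \<in> unit_simple \<Longrightarrow>
    ucp_dist M T (simple_integral X R) (simple_integral Y R) \<le> emery_dist M F T X Y"
  unfolding emery_dist_alt by (rule order_trans[OF SUP_upper]) auto

lemma right_continuous_process_initial:
  assumes "right_continuous_process X" shows "right_continuous_process (\<lambda>t. X 0)"
  using assms horizon_pos by (intro right_continuous_process_const) (auto simp: right_continuous_process_def)

lemma emery_dist_triangle:
  assumes "right_continuous_process X" "right_continuous_process Y" "right_continuous_process Z"
  shows "emery_dist M F T X Z \<le> emery_dist M F T X Y + emery_dist M F T Y Z"
proof -
  let ?S = "\<lambda>X Y. SUP R\<in>unit_simple. ucp_dist M T (simple_integral X R) (simple_integral Y R)"
  let ?i = "\<lambda>X Y. ucp_dist M T (\<lambda>t. X 0) (\<lambda>t. Y 0)"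
  have "?S X Z \<le> ?S X Y + ?S Y Z"
  proof (rule SUP_least)
    fix R assume R: "R \<in> unit_simple"
    then have "simple_predictable M F T R" by (simp add: unit_simple_def)
    then have "ucp_dist M T (simple_integral X R) (simple_integral Z R) \<le>
      ucp_dist M T (simple_integral X R) (simple_integral Y R) +
      ucp_dist M T (simple_integral Y R) (simple_integral Z R)"
      by (intro ucp_dist_triangle simple_integral_right_continuous_process assms)
    also have "\<dots> \<le> ?S X Y + ?S Y Z"
      using R by (intro add_mono SUP_upper)
    finally show "ucp_dist M T (simple_integral X R) (simple_integral Z R) \<le> ?S X Y + ?S Y Z" .
  qed
  moreover have "?i X Z \<le> ?i X Y + ?i Y Z"
    by (intro ucp_dist_triangle right_continuous_process_initial assms)
  ultimately have "emery_dist M F T X Z \<le> (?i X Y + ?i Y Z) + (?S X Y + ?S Y Z)"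
    unfolding emery_dist_alt by (rule add_mono[rotated])
  then show ?thesis unfolding emery_dist_alt by (simp add: add_ac)
qed

lemma simple_integral_tendsto:
  assumes lim: "\<And>t. t \<in> {0..T} \<Longrightarrow> (\<lambda>k. Z k t \<omega>) \<longlonglongrightarrow> Y t \<omega>"
    and R: "simple_predictable M F T R" and \<omega>: "\<omega> \<in> space M" and t: "t \<in> {0..T}"
  shows "(\<lambda>k. simple_integral (Z k) R t \<omega>) \<longlonglongrightarrow> simple_integral Y R t \<omega>"
proof -
  have "(\<lambda>k. \<Sum>(h, \<sigma>, \<tau>)\<leftarrow>xs. h \<omega> * (Z k (min (\<tau> \<omega>) t) \<omega> - Z k (min (\<sigma> \<omega>) t) \<omega>))
      \<longlonglongrightarrow> (\<Sum>(h, \<sigma>, \<tau>)\<leftarrow>xs. h \<omega> * (Y (min (\<tau> \<omega>) t) \<omega> - Y (min (\<sigma> \<omega>) t) \<omega>))"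
    if "set xs \<subseteq> set (snd R)" for xs
    using that
  proof (induction xs)
    case (Cons x xs)
    obtain h \<sigma> \<tau> where x: "x = (h, \<sigma>, \<tau>)" by (cases x)
    with Cons.prems have "(h, \<sigma>, \<tau>) \<in> set (snd R)" by auto
    from simple_predictable_measurable(4,5)[OF R this \<omega>] t
    have "min (\<tau> \<omega>) t \<in> {0..T}" "min (\<sigma> \<omega>) t \<in> {0..T}" by auto
    then show ?case
      using Cons unfolding x by (auto intro!: tendsto_add tendsto_mult_left tendsto_diff lim)
  qed simp
  then show ?thesis unfolding simple_integral_def by blast
qed

text \<open>The bound on the whole distance bounds each of its two terms by \<open>e\<close>, and
  Fatou is applied to each term, and to each integrand of the supremum, separately. Hence the
  harmless factor 2.\<close>

lemma emery_dist_fatou: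
  assumes X: "right_continuous_process X" and Z: "\<And>k. right_continuous_process (Z k)"
    and lim: "AE \<omega> in M. \<forall>t\<in>{0..T}. (\<lambda>k. Z k t \<omega>) \<longlonglongrightarrow> Y t \<omega>"
    and le: "\<forall>\<^sub>F k in sequentially. emery_dist M F T X (Z k) \<le> e"
  shows "emery_dist M F T X Y \<le> e + e"
  unfolding emery_dist_alt
proof (intro add_mono SUP_least)
  show "ucp_dist M T (\<lambda>t. X 0) (\<lambda>t. Y 0) \<le> e"
  proof (rule ucp_dist_fatou[of _ "\<lambda>k t. Z k 0"])
    show "AE \<omega> in M. \<forall>t\<in>{0..T}. (\<lambda>k. Z k 0 \<omega>) \<longlonglongrightarrow> Y 0 \<omega>"
      using lim horizon_pos by (auto elim!: eventually_mono)
    show "\<forall>\<^sub>F k in sequentially. ucp_dist M T (\<lambda>t. X 0) (\<lambda>t. Z k 0) \<le> e"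
      using le by eventually_elim (rule order_trans[OF emery_dist_ge_initial])
  qed (intro right_continuous_process_initial X Z)+
next
  fix R assume R: "R \<in> unit_simple"
  then have sp: "simple_predictable M F T R" by (simp add: unit_simple_def)
  show "ucp_dist M T (simple_integral X R) (simple_integral Y R) \<le> e"
  proof (rule ucp_dist_fatou)
    show "AE \<omega> in M. \<forall>t\<in>{0..T}. (\<lambda>k. simple_integral (Z k) R t \<omega>) \<longlonglongrightarrow> simple_integral Y R t \<omega>"
      using lim AE_space by eventually_elim (auto intro!: simple_integral_tendsto sp)
    show "\<forall>\<^sub>F k in sequentially. ucp_dist M T (simple_integral X R) (simple_integral (Z k) R) \<le> e"
      using le by eventually_elim (rule order_trans[OF emery_dist_ge_simple[OF R]])
  qed (intro simple_integral_right_continuous_process X Z sp)+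
qed

lemma simple_predictable_indicator: "simple_predictable M F T (\<lambda>_. 0, [(\<lambda>_. 1, \<lambda>_. 0, \<lambda>_. T)])"
  using horizon_pos by (auto simp: simple_predictable_def stopping_time_const)

text \<open>The integrand 1 on the half-open interval from 0 to \<open>T\<close> has elementary
  integral \<open>X t \<omega> - X 0 \<omega>\<close>; the missing initial value is controlled by
  the first term of the Emery distance.\<close>

lemma ucp_dist_le_emery_dist:
  assumes "right_continuous_process X" "right_continuous_process Y"
  shows "ucp_dist M T X Y \<le> emery_dist M F T X Y"
proof -
  let ?R = "(\<lambda>_. 0, [(\<lambda>_. 1, \<lambda>_. 0, \<lambda>_. T)])"
  let ?X = "simple_integral X ?R" and ?Y = "simple_integral Y ?R"
  have R: "?R \<in> unit_simple"
    using simple_predictable_indicator by (auto simp: unit_simple_def simple_process_def)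
  have "ucp_dist M T X Y \<le> ucp_dist M T (\<lambda>t. X 0) (\<lambda>t. Y 0) + ucp_dist M T ?X ?Y"
  proof (rule ucp_dist_le_add)
    fix t \<omega> assume "t \<in> {0..T}"
    then have "min T t = t" "min 0 t = 0" by auto
    then show "\<bar>X t \<omega> - Y t \<omega>\<bar> \<le> \<bar>X 0 \<omega> - Y 0 \<omega>\<bar> + \<bar>?X t \<omega> - ?Y t \<omega>\<bar>"
      by (simp add: simple_integral_def)
  qed (intro right_continuous_process_initial
        simple_integral_right_continuous_process simple_predictable_indicator assms)+
  also have "\<dots> \<le> emery_dist M F T X Y"
    unfolding emery_dist_alt using R by (intro add_mono SUP_upper) auto
  finally show ?thesis .
qed

text \<open>Summability of the expectations makes \<open>\<Sum>\<^sub>k 1 \<and> sup\<^sub>t |Z\<^sub>k - Z\<^sub>k\<^sub>+\<^sub>1|\<close> finite almost surely; the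
  truncation at 1 is then eventually inactive and the Weierstrass M-test applies.\<close>

lemma ucp_summable_AE_uniform_limit:
  assumes Z: "\<And>k. right_continuous_process (Z k)"
    and sm: "\<And>k. ucp_dist M T (Z k) (Z (Suc k)) \<le> ennreal ((1/2)^k)"
  shows "AE \<omega> in M. uniform_limit {0..T} (\<lambda>k t. Z k t \<omega>) (\<lambda>t. lim (\<lambda>k. Z k t \<omega>)) sequentially"
proof -
  define f where "f k \<omega> = min 1 (SUP t\<in>{0..T}. ennreal \<bar>Z k t \<omega> - Z (Suc k) t \<omega>\<bar>)" for k \<omega>
  have f[measurable]: "f k \<in> borel_measurable M" for k
    unfolding f_def by (intro ucp_integrand_measurable Z)
  have geometric: "(\<Sum>k. ennreal ((1/2)^k)) \<noteq> top"
    by (intro ennreal_suminf_neq_top summable_geometric) auto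
  have "(\<integral>\<^sup>+\<omega>. (\<Sum>k. f k \<omega>) \<partial>M) = (\<Sum>k. \<integral>\<^sup>+\<omega>. f k \<omega> \<partial>M)"
    by (intro nn_integral_suminf f)
  also have "\<dots> \<le> (\<Sum>k. ennreal ((1/2)^k))"
    using sm by (intro suminf_le) (auto simp: ucp_dist_def f_def)
  finally have "(\<integral>\<^sup>+\<omega>. (\<Sum>k. f k \<omega>) \<partial>M) \<noteq> \<infinity>"
    using geometric neq_top_trans unfolding infinity_ennreal_def by blast
  then have "AE \<omega> in M. (\<Sum>k. f k \<omega>) \<noteq> \<infinity>"
    by (intro nn_integral_noteq_infinite) auto
  then show ?thesis
  proof eventually_elim
    case (elim \<omega>)
    \<comment> \<open>The truncated suprema are at most 1, hence finite, and can be read as real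
      majorants for the M-test.\<close>
    define c where "c k = enn2real (f k \<omega>)" for k
    have "f k \<omega> \<le> 1" for k by (simp add: f_def)
    then have c: "f k \<omega> = ennreal (c k)" for k
      unfolding c_def using neq_top_trans[OF ennreal_one_neq_top] by (simp add: ennreal_enn2real_if)
    have "summable c"
      using elim unfolding c infinity_ennreal_def
      by (intro summable_suminf_not_top) (simp_all add: c_def)
    then have "c \<longlonglongrightarrow> 0" by (rule summable_LIMSEQ_zero)
    then have "\<forall>\<^sub>F k in sequentially. c k < 1" by (rule order_tendstoD) simp
    then have "\<forall>\<^sub>F k in sequentially. \<forall>t\<in>{0..T}. norm (Z (Suc k) t \<omega> - Z k t \<omega>) \<le> c k"
    proof eventually_elim
      case (elim k)
      then have "f k \<omega> < 1" using c by (simp add: ennreal_less_one_iff)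
      then have "f k \<omega> = (SUP t\<in>{0..T}. ennreal \<bar>Z k t \<omega> - Z (Suc k) t \<omega>\<bar>)"
        by (auto simp: f_def min_def split: if_splits)
      then have "ennreal \<bar>Z k t \<omega> - Z (Suc k) t \<omega>\<bar> \<le> ennreal (c k)" if "t \<in> {0..T}" for t
        unfolding c[symmetric] using that by (auto intro: SUP_upper)
      then show ?case
        by (auto simp: c_def abs_minus_commute)
    qed
    then have "uniform_limit {0..T} (\<lambda>n t. \<Sum>k<n. Z (Suc k) t \<omega> - Z k t \<omega>)
        (\<lambda>t. \<Sum>k. Z (Suc k) t \<omega> - Z k t \<omega>) sequentially" (is "uniform_limit _ _ ?g _")
      using \<open>summable c\<close> by (rule Weierstrass_m_test_ev)
    \<comment> \<open>The series telescopes: adding \<open>Z 0\<close> to its \<open>n\<close>-th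
      partial sum gives back \<open>Z n\<close>.\<close>
    then have "uniform_limit {0..T} (\<lambda>n t. (\<Sum>k<n. Z (Suc k) t \<omega> - Z k t \<omega>) + Z 0 t \<omega>)
        (\<lambda>t. ?g t + Z 0 t \<omega>) sequentially"
      by (intro uniform_limit_add uniform_limit_const)
    then have ul: "uniform_limit {0..T} (\<lambda>n t. Z n t \<omega>) (\<lambda>t. ?g t + Z 0 t \<omega>) sequentially"
      by (simp add: sum_lessThan_telescope[of "\<lambda>k. Z k _ \<omega>"])
    have lim: "lim (\<lambda>k. Z k t \<omega>) = ?g t + Z 0 t \<omega>" if "t \<in> {0..T}" for t
      using tendsto_uniform_limitI[OF ul that] by (rule limI)
    show ?case
      by (rule uniform_limit_cong'[THEN iffD1, OF _ _ ul]) (simp_all add: lim)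
  qed
qed

section \<open>Emery limits of semimartingales and completeness\<close>

lemma semimartingale_right_continuous_process:
  "semimartingale M F T X \<Longrightarrow> right_continuous_process X"
  by (simp add: semimartingale_def adapted_cadlag_right_continuous_process)

text \<open>Markov's inequality at the terminal time. The ucp integrand is truncated at 1, so on the
  event it is bounded below by \<open>min 1 e\<close> and not by \<open>e\<close>.\<close>

lemma measure_le_ucp_dist:
  assumes X: "right_continuous_process X" and Y: "right_continuous_process Y" and e: "e > 0"
  shows "ennreal (min 1 e * measure M {\<omega>\<in>space M. e < \<bar>X T \<omega> - Y T \<omega>\<bar>}) \<le> ucp_dist M T X Y"
proof -
  let ?A = "{\<omega>\<in>space M. e < \<bar>X T \<omega> - Y T \<omega>\<bar>}"
  have T: "T \<in> {0..T}" using horizon_pos by simp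
  have [measurable]: "X T \<in> borel_measurable M" "Y T \<in> borel_measurable M"
    using X Y T by (auto simp: right_continuous_process_def)
  have A: "?A \<in> sets M" by measurable
  have "ennreal (min 1 e * measure M ?A) = ennreal (min 1 e) * emeasure M ?A"
    using e by (simp add: ennreal_mult emeasure_eq_measure)
  also have "\<dots> = (\<integral>\<^sup>+\<omega>. ennreal (min 1 e) * indicator ?A \<omega> \<partial>M)"
    using A by (simp add: nn_integral_cmult_indicator)
  also have "\<dots> \<le> ucp_dist M T X Y"
    unfolding ucp_dist_def
  proof (rule nn_integral_mono)
    fix \<omega> assume "\<omega> \<in> space M"
    show "ennreal (min 1 e) * indicator ?A \<omega> \<le> min 1 (SUP t\<in>{0..T}. ennreal \<bar>X t \<omega> - Y t \<omega>\<bar>)"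
    proof (cases "\<omega> \<in> ?A")
      case True
      then have "ennreal (min 1 e) \<le> ennreal \<bar>X T \<omega> - Y T \<omega>\<bar>"
        by (intro ennreal_leI) auto
      also have "\<dots> \<le> (SUP t\<in>{0..T}. ennreal \<bar>X t \<omega> - Y t \<omega>\<bar>)"
        using T by (intro SUP_upper)
      finally show ?thesis
        using True ennreal_leI[of "min 1 e" 1] by simp
    qed simp
  qed
  finally show ?thesis .
qed

text \<open>A uniformly small difference of integrands lies in the unit ball, over which the integrals with
  respect to \<open>Y\<close> and to an approximating semimartingale are uniformly close.\<close>

lemma emery_limit_semimartingale:
  assumes Z: "\<And>k. semimartingale M F T (Z k)" and Y: "adapted_cadlag M F T Y"
    and lim: "(\<lambda>k. emery_dist M F T (Z k) Y) \<longlonglongrightarrow> 0"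
  shows "semimartingale M F T Y"
  unfolding semimartingale_def
proof (intro conjI Y allI impI)
  fix Q R and \<epsilon> :: real
  assume QR: "(\<forall>n. simple_predictable M F T (Q n)) \<and> simple_predictable M F T R \<and>
        uniform_limit ({0..T} \<times> space M) (\<lambda>n (t, \<omega>). simple_process (Q n) t \<omega>)
          (\<lambda>(t, \<omega>). simple_process R t \<omega>) sequentially" and \<epsilon>: "0 < \<epsilon>"
  let ?B = "\<lambda>X \<epsilon> n. {\<omega>\<in>space M. \<epsilon> < \<bar>simple_integral X (Q n) T \<omega> - simple_integral X R T \<omega>\<bar>}"
  have T: "T \<in> {0..T}" using horizon_pos by simp
  show "(\<lambda>n. measure M (?B Y \<epsilon> n)) \<longlonglongrightarrow> 0"
  proof (rule order_tendstoI)
    fix \<delta> :: real assume \<delta>: "0 < \<delta>"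
    \<comment> \<open>The constant of Markov's inequality at level \<open>\<epsilon>/2\<close>.
      Emery distance below \<open>c * (\<delta>/2)\<close> will make the event \<open>?C\<close>
      below have measure less than \<open>\<delta>/2\<close>, for all late \<open>n\<close> at
      once.\<close>
    define c where "c = min 1 (\<epsilon>/2)"
    have c: "c > 0" using \<epsilon> by (simp add: c_def)
    have "\<forall>\<^sub>F k in sequentially. emery_dist M F T (Z k) Y < ennreal (c * (\<delta>/2))"
      using c \<delta> by (intro order_tendstoD(2)[OF lim]) simp
    then obtain k where k: "emery_dist M F T (Z k) Y < ennreal (c * (\<delta>/2))"
      by (auto simp: eventually_sequentially)
    \<comment> \<open>Only after \<open>k\<close> is fixed does \<open>n\<close> tend to infinity,
      using that \<open>Z k\<close> is a semimartingale.\<close>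
    have "(\<lambda>n. measure M (?B (Z k) (\<epsilon>/2) n)) \<longlonglongrightarrow> 0"
      using Z[of k] QR half_gt_zero[OF \<epsilon>] unfolding semimartingale_def by blast
    then have "\<forall>\<^sub>F n in sequentially. measure M (?B (Z k) (\<epsilon>/2) n) < \<delta>/2"
      using \<delta> by (intro order_tendstoD(2)) auto
    moreover have "\<forall>\<^sub>F n in sequentially. \<forall>x\<in>{0..T} \<times> space M.
        dist (case x of (t, \<omega>) \<Rightarrow> simple_process (Q n) t \<omega>)
          (case x of (t, \<omega>) \<Rightarrow> simple_process R t \<omega>) < 1"
      using QR by (intro uniform_limitD) auto
    ultimately show "\<forall>\<^sub>F n in sequentially. measure M (?B Y \<epsilon> n) < \<delta>"
    proof eventually_elim
      case (elim n)
      let ?P = "simple_diff (Q n) R"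
      have sp: "simple_predictable M F T ?P" using QR by (intro simple_predictable_diff) auto
      have "?P \<in> unit_simple"
        using elim(2) sp by (force simp: unit_simple_def simple_process_diff dist_real_def)
      note rc = simple_integral_right_continuous_process[OF semimartingale_right_continuous_process[OF Z] sp, of k]
        simple_integral_right_continuous_process[OF adapted_cadlag_right_continuous_process[OF Y] sp]
      let ?C = "{\<omega>\<in>space M. \<epsilon>/2 < \<bar>simple_integral (Z k) ?P T \<omega> - simple_integral Y ?P T \<omega>\<bar>}"
      have "ennreal (c * measure M ?C) \<le> ucp_dist M T (simple_integral (Z k) ?P) (simple_integral Y ?P)"
        unfolding c_def using \<epsilon> by (intro measure_le_ucp_dist rc) auto
      also have "\<dots> \<le> emery_dist M F T (Z k) Y"
        by (rule emery_dist_ge_simple[OF \<open>?P \<in> unit_simple\<close>])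
      also note k
      finally have C: "measure M ?C < \<delta>/2"
        using c by (simp add: ennreal_less_iff)
      have m[measurable]: "simple_integral (Z k) ?P T \<in> borel_measurable M"
        "simple_integral Y ?P T \<in> borel_measurable M"
        using rc T by (auto simp: right_continuous_process_def)
      have B_eq: "?B X \<rho> n = {\<omega>\<in>space M. \<rho> < \<bar>simple_integral X ?P T \<omega>\<bar>}" for X \<rho>
        by (simp add: simple_integral_diff)
      have "?B Y \<epsilon> n \<subseteq> ?B (Z k) (\<epsilon>/2) n \<union> ?C"
      proof
        fix \<omega> assume "\<omega> \<in> ?B Y \<epsilon> n"
        moreover have "\<bar>b\<bar> \<le> \<bar>a\<bar> + \<bar>a - b\<bar>" for a b :: real by linarith
        note this[of "simple_integral Y ?P T \<omega>" "simple_integral (Z k) ?P T \<omega>"]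
        ultimately show "\<omega> \<in> ?B (Z k) (\<epsilon>/2) n \<union> ?C"
          unfolding B_eq by auto
      qed
      moreover have "?B (Z k) (\<epsilon>/2) n \<in> sets M" "?C \<in> sets M"
        unfolding B_eq by measurable
      ultimately have "measure M (?B Y \<epsilon> n) \<le> measure M (?B (Z k) (\<epsilon>/2) n) + measure M ?C"
        by (intro order_trans[OF finite_measure_mono measure_Un_le]) auto
      then show ?case using C elim(1) by simp
    qed
  next
    fix a :: real assume "a < 0"
    then have "a < measure M (?B Y \<epsilon> n)" for n
      by (rule less_le_trans) (rule measure_nonneg)
    then show "\<forall>\<^sub>F n in sequentially. a < measure M (?B Y \<epsilon> n)"
      by simp
  qed
qed

lemma emery_complete:
  assumes "emery_Cauchy M F T Y"
  shows "\<exists>Y'. emery_tendsto M F T Y Y'"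
proof -
  have sm: "semimartingale M F T (Y n)" for n
    using assms by (simp add: emery_Cauchy_def)
  note rc = semimartingale_right_continuous_process[OF sm]
  have cauchy: "\<exists>N. \<forall>m\<ge>N. \<forall>n\<ge>N. emery_dist M F T (Y m) (Y n) < \<epsilon>" if "\<epsilon> > 0" for \<epsilon>
    using assms that by (simp add: emery_Cauchy_def)
  have "\<forall>k. \<exists>N. \<forall>m\<ge>N. \<forall>n\<ge>N. emery_dist M F T (Y m) (Y n) < ennreal ((1/2)^k)"
    by (intro allI cauchy) simp
  then obtain N where N: "\<And>k m n. m \<ge> N k \<Longrightarrow> n \<ge> N k \<Longrightarrow> emery_dist M F T (Y m) (Y n) < ennreal ((1/2)^k)"
    by metis
  \<comment> \<open>The sum puts both \<open>r k\<close> and \<open>r (Suc k)\<close> beyond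
    \<open>N k\<close>, so consecutive terms are close; the summand \<open>k\<close> forces
    \<open>r\<close> to infinity.\<close>
  define r where "r k = (\<Sum>i\<le>k. N i) + k" for k
  have r: "N k \<le> r k" "N k \<le> r (Suc k)" "k \<le> r k" for k
    by (simp_all add: r_def atMost_Suc sum.lessThan_Suc flip: lessThan_Suc_atMost)
  \<comment> \<open>Taking the pointwise \<open>lim\<close> at every outcome, with its constant
    default where there is no convergence, keeps \<open>Y' t\<close> measurable in
    \<open>F t\<close> itself.\<close>
  define Y' where "Y' t \<omega> = lim (\<lambda>k. Y (r k) t \<omega>)" for t \<omega>
  have ul: "AE \<omega> in M. uniform_limit {0..T} (\<lambda>k t. Y (r k) t \<omega>) (\<lambda>t. Y' t \<omega>) sequentially"
    unfolding Y'_def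
  proof (rule ucp_summable_AE_uniform_limit[OF rc])
    fix k
    show "ucp_dist M T (Y (r k)) (Y (r (Suc k))) \<le> ennreal ((1/2)^k)"
      using ucp_dist_le_emery_dist[OF rc rc] N[OF r(1,2)] by (blast intro: order_trans less_imp_le)
  qed
  have Y': "adapted_cadlag M F T Y'"
    unfolding adapted_cadlag_def
  proof
    show "\<forall>t\<in>{0..T}. Y' t \<in> borel_measurable (F t)"
    proof
      fix t assume "t \<in> {0..T}"
      then have "Y (r k) t \<in> borel_measurable (F t)" for k
        using sm by (auto simp: semimartingale_def adapted_cadlag_def)
      then have "(\<lambda>\<omega>. lim (\<lambda>k. Y (r k) t \<omega>)) \<in> borel_measurable (F t)"
        by measurable
      then show "Y' t \<in> borel_measurable (F t)"
        by (simp add: Y'_def[abs_def])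
    qed
    have "AE \<omega> in M. \<forall>k. cadlag_on T (\<lambda>t. Y (r k) t \<omega>)"
      using sm by (auto simp: AE_all_countable semimartingale_def adapted_cadlag_def)
    then show "AE \<omega> in M. cadlag_on T (\<lambda>t. Y' t \<omega>)"
      using ul by eventually_elim (auto intro: uniform_limit_cadlag_on)
  qed
  have lim: "AE \<omega> in M. \<forall>t\<in>{0..T}. (\<lambda>k. Y (r k) t \<omega>) \<longlonglongrightarrow> Y' t \<omega>"
    using ul by eventually_elim (auto intro: tendsto_uniform_limitI)
  have conv: "(\<lambda>n. emery_dist M F T (Y n) Y') \<longlonglongrightarrow> 0"
  proof (rule tendsto_zero_ennreal)
    fix \<epsilon> :: real assume \<epsilon>: "0 < \<epsilon>"
    \<comment> \<open>The Fatou bound doubles the estimate, and twice a third stays strictly below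
      \<open>\<epsilon>\<close>. Comparing an arbitrary \<open>Y n\<close> with the subsequence
      gives convergence of the whole sequence.\<close>
    obtain n0 where n0: "\<And>m n. m \<ge> n0 \<Longrightarrow> n \<ge> n0 \<Longrightarrow> emery_dist M F T (Y m) (Y n) < ennreal (\<epsilon>/3)"
      using cauchy[of "ennreal (\<epsilon>/3)"] \<epsilon> by auto
    have "emery_dist M F T (Y n) Y' \<le> ennreal (\<epsilon>/3) + ennreal (\<epsilon>/3)" if "n \<ge> n0" for n
    proof (rule emery_dist_fatou[OF rc rc lim])
      show "\<forall>\<^sub>F k in sequentially. emery_dist M F T (Y n) (Y (r k)) \<le> ennreal (\<epsilon>/3)"
        using eventually_ge_at_top[of n0]
      proof eventually_elim
        case (elim k)
        with r(3)[of k] have "n0 \<le> r k" by simp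
        with n0[OF that] show ?case by (simp add: less_imp_le)
      qed
    qed
    moreover have "ennreal (\<epsilon>/3) + ennreal (\<epsilon>/3) < ennreal \<epsilon>"
      using \<epsilon> by (simp add: ennreal_less_iff flip: ennreal_plus)
    ultimately have "emery_dist M F T (Y n) Y' < ennreal \<epsilon>" if "n \<ge> n0" for n
      using that by (blast intro: le_less_trans)
    then show "\<forall>\<^sub>F n in sequentially. emery_dist M F T (Y n) Y' < ennreal \<epsilon>"
      by (auto simp: eventually_sequentially)
  qed
  show ?thesis
    using emery_limit_semimartingale[OF sm Y' conv] sm conv by (auto simp: emery_tendsto_def)
qed

section \<open>Generalized integrands as limits of simple ones\<close>

text \<open>Supplies the exceptional set for a convergence that holds everywhere. A countable dense
  subset of \<open>I\<close> exists because the real line is second countable.\<close>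

lemma negligible_wrt_empty: "negligible_wrt M F T I S {}"
  unfolding negligible_wrt_def
proof (intro conjI)
  obtain D where D: "countable D" "D \<subseteq> I" "I \<subseteq> closure D"
    using separable[of I] by blast
  have "has_stochastic_integral M F T X h (\<lambda>t \<omega>. 0)"
    if h: "\<forall>t\<in>{0..T}. \<forall>\<omega>\<in>space M. h t \<omega> = 0" for X h
  \<comment> \<open>The integrand \<open>h\<close> vanishes only at relevant times and outcomes and
    may differ from a simple process elsewhere. A constant sequence of zero simple processes reaches
    it, since the limit rule tests integrands only there.\<close>
  proof (rule has_stochastic_integral.limit)
    let ?R = "(\<lambda>_. 0, [])"
    show "has_stochastic_integral M F T X (simple_process ?R) (simple_integral X ?R)"
      by (rule has_stochastic_integral.simple) (auto simp: simple_predictable_def)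
    show "\<bar>simple_process ?R t \<omega>\<bar> \<le> 0" for t \<omega>
      by (simp add: simple_process_def)
    show "(\<lambda>n. simple_process ?R t \<omega>) \<longlonglongrightarrow> h t \<omega>" if "t \<in> {0..T}" "\<omega> \<in> space M" for t \<omega>
      using h that by (simp add: simple_process_def)
    show "adapted_cadlag M F T (\<lambda>t \<omega>. 0)"
      by (auto simp: adapted_cadlag_def cadlag_on_def)
    show "(\<lambda>n. ucp_dist M T (simple_integral X ?R) (\<lambda>t \<omega>. 0)) \<longlonglongrightarrow> 0"
      using horizon_pos by (simp add: ucp_dist_def simple_integral_def)
  qed
  then show "\<exists>D. countable D \<and> D \<subseteq> I \<and> I \<subseteq> closure D \<and>
        (\<forall>x\<in>D. \<forall>h. bounded_predictable M F T h \<and>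
            (\<forall>t\<in>{0..T}. \<forall>\<omega>\<in>space M. (\<omega>, t) \<notin> {} \<longrightarrow> h t \<omega> = 0) \<longrightarrow>
            has_stochastic_integral M F T (S x) h (\<lambda>t \<omega>. 0))"
    using D by (intro exI[of _ D]) auto
qed simp

end

theorem theorem2p4:
  fixes M :: "'a measure" and F :: "real \<Rightarrow> 'a measure" and T :: real and I :: "real set"
    and S :: "real \<Rightarrow> real \<Rightarrow> 'a \<Rightarrow> real"
    and H :: "nat \<Rightarrow> real \<Rightarrow> 'a \<Rightarrow> ((real \<Rightarrow> real) \<rightharpoonup> real)"
    and Y :: "nat \<Rightarrow> real \<Rightarrow> 'a \<Rightarrow> real"
  assumes "usual_filtered_space M F T"
    and "locally compact I"
    and "emery_continuous_family M F T I S"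
    and "\<And>n. has_generalized_integral M F T I S (H n) (Y n)"
    and "emery_Cauchy M F T Y"
  shows "\<exists>H' Y'. has_generalized_integral M F T I S H' Y' \<and> emery_tendsto M F T Y Y'"
proof -
  interpret usual_filtered_space M F T by fact
  obtain Y' where Y': "emery_tendsto M F T Y Y'"
    using emery_complete[OF assms(5)] by blast
  \<comment> \<open>Diagonal choice: the error \<open>1 / Suc n\<close> tends to 0, so the chosen
    integrals have the same Emery limit as the \<open>Y n\<close>.\<close>
  have "\<exists>K Z. has_simple_integrand_integral M F T I S K Z \<and> semimartingale M F T Z \<and>
      emery_dist M F T Z (Y n) < ennreal (1 / Suc n)" for n
  proof -
    obtain K Z where KZ: "\<And>j. has_simple_integrand_integral M F T I S (K j) (Z j)"
        "emery_tendsto M F T Z (Y n)"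
      using assms(4)[of n] unfolding has_generalized_integral_def by blast
    then have "(\<lambda>j. emery_dist M F T (Z j) (Y n)) \<longlonglongrightarrow> 0"
      by (simp add: emery_tendsto_def)
    then have "\<forall>\<^sub>F j in sequentially. emery_dist M F T (Z j) (Y n) < ennreal (1 / Suc n)"
      by (rule order_tendstoD) simp
    then obtain j where "emery_dist M F T (Z j) (Y n) < ennreal (1 / Suc n)"
      by (auto simp: eventually_sequentially)
    then show ?thesis
      using KZ by (auto simp: emery_tendsto_def)
  qed
  then obtain K Z where KZ: "\<And>n. has_simple_integrand_integral M F T I S (K n) (Z n)"
      "\<And>n. semimartingale M F T (Z n)" "\<And>n. emery_dist M F T (Z n) (Y n) < ennreal (1 / Suc n)"
    by metis
  have sm: "semimartingale M F T (Y n)" "semimartingale M F T Y'" for n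
    using Y' by (auto simp: emery_tendsto_def)
  have "(\<lambda>n. emery_dist M F T (Z n) Y') \<longlonglongrightarrow> 0"
  proof (rule tendsto_sandwich[OF _ _ tendsto_const])
    have "emery_dist M F T (Z n) Y' \<le> ennreal (1 / Suc n) + emery_dist M F T (Y n) Y'" for n
      using emery_dist_triangle[of "Z n" "Y n" Y'] KZ(2,3)[of n] sm
      by (meson add_right_mono less_imp_le order_trans semimartingale_right_continuous_process)
    then show "\<forall>\<^sub>F n in sequentially. emery_dist M F T (Z n) Y' \<le>
        ennreal (1 / Suc n) + emery_dist M F T (Y n) Y'"
      by simp
    have "(\<lambda>n. ennreal (1 / Suc n) + emery_dist M F T (Y n) Y') \<longlonglongrightarrow> ennreal 0 + 0"
      using Y' by (intro tendsto_add tendsto_ennrealI LIMSEQ_Suc[OF lim_1_over_n])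
        (auto simp: emery_tendsto_def)
    then show "(\<lambda>n. ennreal (1 / Suc n) + emery_dist M F T (Y n) Y') \<longlonglongrightarrow> 0"
      by simp
  qed simp
  then have ZY': "emery_tendsto M F T Z Y'"
    using KZ(2) sm by (simp add: emery_tendsto_def)
  \<comment> \<open>The limit is taken separately at each time and outcome; the domain of the
    functional may vary with them.\<close>
  define H' where "H' t \<omega> = limit_functional I (\<lambda>n. K n t \<omega>)" for t \<omega>
  have "H' t \<omega> \<in> partial_functionals I" if "t \<in> {0..T}" "\<omega> \<in> space M" for t \<omega>
    unfolding H'_def
  proof (rule limit_functional_in_partial_functionals)
    fix n
    obtain m :: nat and x h where "\<forall>i<m. x i \<in> I"
        "\<forall>t\<in>{0..T}. \<forall>\<omega>\<in>space M. \<forall>f\<in>function_space I. K n t \<omega> f = (\<Sum>i<m. h i t \<omega> * f (x i))"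
      using KZ(1)[of n] unfolding has_simple_integrand_integral_def by blast
    then show "\<exists>(m::nat) x c. (\<forall>i<m. x i \<in> I) \<and>
        (\<forall>f\<in>function_space I. K n t \<omega> f = (\<Sum>i<m. c i * f (x i)))"
      using that by (intro exI[of _ m] exI[of _ x] exI[of _ "\<lambda>i. h i t \<omega>"]) auto
  qed
  \<comment> \<open>Convergence on the domain is built into the limit functional, so the exceptional
    set is empty.\<close>
  moreover have "almost_surely_wrt M F T I S (\<lambda>t \<omega>. functional_tendsto (\<lambda>n. K n t \<omega>) (H' t \<omega>))"
    unfolding almost_surely_wrt_def H'_def
    using negligible_wrt_empty functional_tendsto_limit_functional by blast
  ultimately have "has_generalized_integral M F T I S H' Y'"
    using KZ(1) ZY' unfolding has_generalized_integral_def by blast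
  with Y' show ?thesis by blast
qed

end
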